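(* Let $U:\mathbb{R}^d\to\mathbb{R}$ be continuously differentiable with $\int e^{-U}<\infty$, and assume that for some $\beta\in[0,1]$ there exist $L_1,M_1\ge0$ with $\|\nabla U(q)-\nabla U(\tilde q)\|\le L_1\|q-\tilde q\|$ and $\|\nabla U(q)\|\le M_1(1+\|q\|^\beta)$ for all $q,\tilde q\in\mathbb{R}^d$. (a) If $\beta\in[0,1)$, then for all $h>0$ and $T\in\mathbb{N}^*$, the HMC kernel $P_{h,T}$ is irreducible, the Lebesgue measure is an irreducibility measure, and every compact subset of $\mathbb{R}^d$ is small. (b) If $\beta=1$, then for all $T\in\mathbb{N}^*$ there exists $\bar h_T>0$ such that for all $h\in(0,\bar h_T]$, $P_{h,T}$ is irreducible, the Lebesgue measure is an irreducibility measure, and every compact subset of $\mathbb{R}^d$ is small. Moreover, in either case (a) or (b) (for the corresponding $h,T$), $P_{h,T}$ is aperiodic and recurrent, and for $\pi$-almost every $q\in\mathbb{R}^d$, $\lim_{n\to\infty}\|\delta_qP_{h,T}^n-\pi\|_{TV}=0$.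
   Context: $\pi$ is the probability density on $\mathbb{R}^d$ proportional to $e^{-U}$. $H(q,p)=U(q)+\|p\|^2/2$. For $h>0$, the leapfrog map is $\Phi_h=\Psi^{(1)}_h\circ\Psi^{(2)}_h\circ\Psi^{(1)}_h$ with $\Psi^{(1)}_h(q,p)=(q,p-(h/2)\nabla U(q))$, $\Psi^{(2)}_h(q,p)=(q+hp,p)$; $\Phi_h^{\circ T}$ is its $T$-fold composition and $\Phi^{q,T}_h$ the position component of $\Phi_h^{\circ T}$. With $\alpha_H((q,p),(\tilde q,\tilde p))=\min[1,\exp(H(q,p)-H(\tilde q,\tilde p))]$ and $\varphi(p)=(2\pi)^{-d/2}e^{-\|p\|^2/2}$, the HMC kernel is $$P_{h,T}(q,A)=\int 1_A(\Phi^{q,T}_h(q,p))\,\alpha_H((q,p),\Phi_h^{\circ T}(q,p))\varphi(p)\,dp+\delta_q(A)\int[1-\alpha_H((q,p),\Phi_h^{\circ T}(q,p))]\varphi(p)\,dp.$$ A set $C$ is small for $P$ if there exist $m\ge1$ and a nontrivial measure $\mu$ with $P^m(x,A)\ge\mu(A)$ for all $x\in C$ and Borel $A$. $P$ is irreducible with irreducibility measure $\mu$ if every Borel $A$ with $\mu(A)>0$ satisfies $\sum_{m\ge1}P^m(x,A)>0$ for all $x$. Recurrent: every accessible set $A$ satisfies $\mathbb{E}_x[N_A]=\infty$ for $x\in A$, with $N_A$ the number of visits to $A$. *)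

theory Defs
  imports "HOL-Probability.Probability"
begin

definition psi1 :: "('a::euclidean_space \<Rightarrow> 'a) \<Rightarrow> real \<Rightarrow> 'a \<times> 'a \<Rightarrow> 'a \<times> 'a" where
  "psi1 gradU h = (\<lambda>(q, p). (q, p - (h / 2) *\<^sub>R gradU q))"

definition psi2 :: "real \<Rightarrow> 'a::euclidean_space \<times> 'a \<Rightarrow> 'a \<times> 'a" where
  "psi2 h = (\<lambda>(q, p). (q + h *\<^sub>R p, p))"

definition leapfrog :: "('a::euclidean_space \<Rightarrow> 'a) \<Rightarrow> real \<Rightarrow> 'a \<times> 'a \<Rightarrow> 'a \<times> 'a" where
  "leapfrog gradU h = psi1 gradU h \<circ> psi2 h \<circ> psi1 gradU h"

definition leapfrogT :: "('a::euclidean_space \<Rightarrow> 'a) \<Rightarrow> real \<Rightarrow> nat \<Rightarrow> 'a \<times> 'a \<Rightarrow> 'a \<times> 'a" where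
  "leapfrogT gradU h T = (leapfrog gradU h ^^ T)"

definition hamiltonian :: "('a::euclidean_space \<Rightarrow> real) \<Rightarrow> 'a \<times> 'a \<Rightarrow> real" where
  "hamiltonian U = (\<lambda>(q, p). U q + (norm p)\<^sup>2 / 2)"

definition alphaH :: "('a::euclidean_space \<Rightarrow> real) \<Rightarrow> 'a \<times> 'a \<Rightarrow> 'a \<times> 'a \<Rightarrow> real" where
  "alphaH U x y = min 1 (exp (hamiltonian U x - hamiltonian U y))"

definition gauss :: "'a::euclidean_space \<Rightarrow> real" where
  "gauss p = (2 * pi) powr (- real DIM('a) / 2) * exp (- (norm p)\<^sup>2 / 2)"

definition hmc_kernel ::
  "('a::euclidean_space \<Rightarrow> real) \<Rightarrow> ('a \<Rightarrow> 'a) \<Rightarrow> real \<Rightarrow> nat \<Rightarrow> 'a \<Rightarrow> 'a set \<Rightarrow> real" where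
  "hmc_kernel U gradU h T q A =
     (LINT p|lborel. indicator A (fst (leapfrogT gradU h T (q, p)))
                     * alphaH U (q, p) (leapfrogT gradU h T (q, p)) * gauss p)
     + indicator A q * (LINT p|lborel. (1 - alphaH U (q, p) (leapfrogT gradU h T (q, p))) * gauss p)"

definition hmc :: "('a::euclidean_space \<Rightarrow> real) \<Rightarrow> ('a \<Rightarrow> 'a) \<Rightarrow> real \<Rightarrow> nat \<Rightarrow> 'a \<Rightarrow> 'a measure" where
  "hmc U gradU h T q = measure_of UNIV (sets borel) (\<lambda>A. ennreal (hmc_kernel U gradU h T q A))"

primrec kpow :: "('a \<Rightarrow> 'a measure) \<Rightarrow> nat \<Rightarrow> 'a \<Rightarrow> 'a set \<Rightarrow> ennreal" where
  "kpow K 0 x A = indicator A x"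
| "kpow K (Suc n) x A = (\<integral>\<^sup>+ y. kpow K n y A \<partial>(K x))"

definition accessible :: "('a::topological_space \<Rightarrow> 'a measure) \<Rightarrow> 'a set \<Rightarrow> bool" where
  "accessible K A \<longleftrightarrow> A \<in> sets borel \<and> (\<forall>x. \<exists>m\<ge>1. kpow K m x A > 0)"

definition irreducibility_measure :: "('a::topological_space \<Rightarrow> 'a measure) \<Rightarrow> 'a measure \<Rightarrow> bool" where
  "irreducibility_measure K \<mu> \<longleftrightarrow> sets \<mu> = sets borel \<and> emeasure \<mu> (space \<mu>) \<noteq> 0 \<and>
     (\<forall>A \<in> sets borel. emeasure \<mu> A > 0 \<longrightarrow> (\<forall>x. \<exists>m\<ge>1. kpow K m x A > 0))"

definition irreducible :: "('a::topological_space \<Rightarrow> 'a measure) \<Rightarrow> bool" where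
  "irreducible K \<longleftrightarrow> (\<exists>\<mu>. irreducibility_measure K \<mu>)"

definition small_set :: "('a::topological_space \<Rightarrow> 'a measure) \<Rightarrow> 'a set \<Rightarrow> bool" where
  "small_set K C \<longleftrightarrow> (\<exists>m\<ge>1. \<exists>\<mu>. sets \<mu> = sets borel \<and> emeasure \<mu> (space \<mu>) \<noteq> 0 \<and>
     (\<forall>x\<in>C. \<forall>A\<in>sets borel. kpow K m x A \<ge> emeasure \<mu> A))"

text \<open>Period of an accessible small set C: gcd of {n \<ge> 1 : inf_{x \<in> C} P^n(x,C) > 0};
  an irreducible kernel is aperiodic if the (common) period of its accessible small sets is 1
  (Douc, Moulines, Priouret, Soulier, Markov Chains, Ch. 9).\<close>
definition small_set_period :: "('a::topological_space \<Rightarrow> 'a measure) \<Rightarrow> 'a set \<Rightarrow> nat" where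
  "small_set_period K C = Gcd {n. n \<ge> 1 \<and> (INF x\<in>C. kpow K n x C) > 0}"

definition aperiodic :: "('a::topological_space \<Rightarrow> 'a measure) \<Rightarrow> bool" where
  "aperiodic K \<longleftrightarrow> irreducible K \<and>
     (\<forall>C. small_set K C \<and> accessible K C \<longrightarrow> small_set_period K C = 1)"

text \<open>E_x[N_A] = \<Sum>_{n\<ge>1} P^n(x,A).\<close>
definition recurrent :: "('a::topological_space \<Rightarrow> 'a measure) \<Rightarrow> bool" where
  "recurrent K \<longleftrightarrow> (\<forall>A. accessible K A \<longrightarrow> (\<forall>x\<in>A. (\<Sum>n. kpow K (Suc n) x A) = \<infinity>))"

definition target :: "('a::euclidean_space \<Rightarrow> real) \<Rightarrow> 'a measure" where
  "target U = density lborel (\<lambda>q. ennreal (exp (- U q) / (LINT x|lborel. exp (- U x))))"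

definition tv_dist_kpow :: "('a::topological_space \<Rightarrow> 'a measure) \<Rightarrow> nat \<Rightarrow> 'a \<Rightarrow> 'a measure \<Rightarrow> real" where
  "tv_dist_kpow K n x \<pi> = (SUP A\<in>sets borel. \<bar>enn2real (kpow K n x A) - measure \<pi> A\<bar>)"

text \<open>Real power with the convention 0^0 = 1.\<close>
definition rpow :: "real \<Rightarrow> real \<Rightarrow> real" where
  "rpow x b = (if b = 0 then 1 else x powr b)"

end

theory Submission
  imports Defs
begin

text \<open>
  The argument rests on a one-step minorization: on every ball the kernel dominates a positive multiple
  of Lebesgue measure. Summing the leapfrog recursion, the final position is
  \<open>q + T h p\<close> plus a remainder controlled by the growth of the gradient, so Brouwer's theorem
  makes the momentum-to-position map onto any ball, with preimages in a fixed compact set;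
  as this map is Lipschitz, it cannot compress the measure of a preimage too much.

  Leapfrog integration followed by a momentum flip is a volume preserving involution, so the target
  is invariant. Let two copies of the chain run independently and discard, whenever both are in the unit ball, the
  symmetric part \<open>\<nu> \<Otimes>\<^sub>M \<nu>\<close> of their joint law, which contributes equally to both marginals.
  The remaining mass \<open>u\<close> decreases to a function invariant for this defective product
  kernel; integrating against the invariant product measure shows that it vanishes almost everywhere
  on the unit square, hence, by the minorization on larger balls, almost everywhere. This gives the
  convergence in total variation; recurrence follows because \<open>P\<^sup>n(x, A)\<close> then
  has a positive limit for almost every \<open>x\<close>.
\<close>

section \<open>Markov chains minorized on balls\<close>

text \<open>The constant of the minorization degenerates as the ball grows, and no drift towards a
  ball is assumed, so no contraction rate is available. An invariant probability equivalent to
  Lebesgue measure takes the place of both: the surviving mass of the coupling is not estimated step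
  by step, its limit is identified through an invariance equation. This yields convergence for
  almost every start only. Statements about every start, as in recurrence, are regained because one
  step from any point already charges every Lebesgue-nonnull subset of a large ball. On the analytic
  side the gradient is only Lipschitz and, for sublinear growth, the step size is arbitrary. The
  momentum-to-position map then need be neither injective nor differentiable, which rules out a
  change of variables; surjectivity with controlled preimages and a Lipschitz constant are all that
  is extracted from it.\<close>

definition ball_lebesgue :: "real \<Rightarrow> real \<Rightarrow> 'a::euclidean_space measure" where
  "ball_lebesgue c r = density lborel (\<lambda>x. ennreal c * indicator (cball 0 r) x)"

lemma sets_ball_lebesgue [simp, measurable_cong]: "sets (ball_lebesgue c r) = sets borel"
  and space_ball_lebesgue [simp]: "space (ball_lebesgue c r) = UNIV"
  by (simp_all add: ball_lebesgue_def)

lemma cball_measurable [measurable]: "cball (x::'a::metric_space) r \<in> sets borel"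
  by simp

lemma emeasure_ball_lebesgue:
  assumes "A \<in> sets borel"
  shows "emeasure (ball_lebesgue c r) A = ennreal c * emeasure lborel (A \<inter> cball 0 r)"
proof -
  have "emeasure (ball_lebesgue c r) A = (\<integral>\<^sup>+x. ennreal c * indicator (A \<inter> cball 0 r) x \<partial>lborel)"
    using assms unfolding ball_lebesgue_def
    by (subst emeasure_density) (auto intro!: nn_integral_cong simp: indicator_def)
  also have "\<dots> = ennreal c * emeasure lborel (A \<inter> cball 0 r)"
    using assms by (simp add: nn_integral_cmult_indicator)
  finally show ?thesis .
qed

lemma emeasure_lborel_cball_pos: "r > 0 \<Longrightarrow> emeasure lborel (cball (x::'a::euclidean_space) r) > 0"
  using emeasure_lborel_cball_finite[of x r] content_cball_pos[of r x]
  by (cases "emeasure lborel (cball x r) = 0") (auto simp: measure_def zero_less_iff_neq_zero)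

lemma finite_measure_ball_lebesgue: "finite_measure (ball_lebesgue c r)"
  using emeasure_lborel_cball_finite[of 0 r]
  by (intro finite_measureI) (auto simp: emeasure_ball_lebesgue ennreal_mult_eq_top_iff less_top[symmetric])

lemma nn_integral_ball_lebesgue_le:
  assumes "ball_lebesgue c r \<le> M" "sets M = sets borel"
  shows "(\<integral>\<^sup>+x. f x \<partial>ball_lebesgue c r) \<le> (\<integral>\<^sup>+x. f x \<partial>M)"
  using assms by (intro nn_integral_mono_measure) auto

lemma AE_ball_lebesgue_iff:
  assumes "c > 0"
  shows "(AE x in ball_lebesgue c r. P x) \<longleftrightarrow> (AE x in lborel. x \<in> cball 0 r \<longrightarrow> P x)"
  unfolding ball_lebesgue_def using assms
  by (subst AE_density) (auto simp: indicator_def ennreal_zero_less_mult_iff intro!: AE_cong)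

text \<open>\<open>kpow\<close> is a bare recursion on numbers. With measures instead, associativity
  of bind gives the Chapman-Kolmogorov equation, and n-step probabilities are bounded by 1, hence
  integrable.\<close>

primrec kiter :: "('a::topological_space \<Rightarrow> 'a measure) \<Rightarrow> nat \<Rightarrow> 'a \<Rightarrow> 'a measure" where
  "kiter K 0 x = return borel x"
| "kiter K (Suc n) x = K x \<bind> kiter K n"

locale markov_kernel =
  fixes K :: "'a::topological_space \<Rightarrow> 'a measure"
  assumes kernel [measurable]: "K \<in> borel \<rightarrow>\<^sub>M prob_algebra borel"
begin

lemma kernel_subprob [measurable]: "K \<in> borel \<rightarrow>\<^sub>M subprob_algebra borel"
  using kernel by (rule measurable_prob_algebraD)

lemma sets_K [simp, measurable_cong]: "sets (K x) = sets borel"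
  and prob_kernel: "prob_space (K x)"
  using measurable_space[OF kernel, of x] by (auto simp: space_prob_algebra)

lemma space_K [simp]: "space (K x) = UNIV"
  using sets_eq_imp_space_eq[OF sets_K[of x]] by simp

lemma measurable_kiter [measurable]: "kiter K n \<in> borel \<rightarrow>\<^sub>M prob_algebra borel"
proof (induction n)
  case 0
  have "kiter K 0 = return borel" by (simp add: fun_eq_iff)
  then show ?case by simp
next
  case (Suc n)
  have "kiter K (Suc n) = (\<lambda>x. K x \<bind> kiter K n)" by (simp add: fun_eq_iff)
  then show ?case using measurable_bind_prob_space[OF kernel Suc] by simp
qed

lemma measurable_kiter_subprob [measurable]: "kiter K n \<in> borel \<rightarrow>\<^sub>M subprob_algebra borel"
  by (rule measurable_prob_algebraD) simp

lemma sets_kiter [simp, measurable_cong]: "sets (kiter K n x) = sets borel"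
  and prob_kiter: "prob_space (kiter K n x)"
  using measurable_space[OF measurable_kiter, of x n] by (auto simp: space_prob_algebra)

lemma emeasure_kiter: "A \<in> sets borel \<Longrightarrow> emeasure (kiter K n x) A = kpow K n x A"
proof (induction n arbitrary: x)
  case (Suc n)
  then show ?case by (simp add: emeasure_bind[where N=borel])
qed simp

lemma kpow_measurable [measurable (raw)]:
  "A \<in> sets borel \<Longrightarrow> (\<lambda>x. kpow K n x A) \<in> borel_measurable borel"
  using measurable_emeasure_kernel[OF measurable_kiter_subprob, of A n]
  by (simp add: emeasure_kiter)

lemma kpow_eq_measure: "A \<in> sets borel \<Longrightarrow> kpow K n x A = ennreal (measure (kiter K n x) A)"
  using finite_measure.emeasure_eq_measure[OF prob_space.finite_measure[OF prob_kiter]] by (metis emeasure_kiter)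

lemma kiter_add: "kiter K (m + n) x = kiter K m x \<bind> kiter K n"
proof (induction m arbitrary: x)
  case 0
  then show ?case by (simp add: bind_return[where N=borel])
next
  case (Suc m)
  have "kiter K (m + n) = (\<lambda>y. kiter K m y \<bind> kiter K n)" by (simp add: fun_eq_iff Suc)
  then have "kiter K (Suc m + n) x = K x \<bind> (\<lambda>y. kiter K m y \<bind> kiter K n)" by simp
  also have "\<dots> = (K x \<bind> kiter K m) \<bind> kiter K n"
    by (rule bind_assoc[symmetric, where N=borel and R=borel]) measurable
  finally show ?case by simp
qed

lemma kpow_add:
  assumes "A \<in> sets borel"
  shows "kpow K (m + n) x A = (\<integral>\<^sup>+y. kpow K n y A \<partial>kiter K m x)"
proof -
  have "kpow K (m + n) x A = emeasure (kiter K m x \<bind> kiter K n) A"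
    using assms by (simp add: kiter_add flip: emeasure_kiter)
  also have "\<dots> = (\<integral>\<^sup>+y. emeasure (kiter K n y) A \<partial>kiter K m x)"
    using assms prob_space.not_empty[OF prob_kiter]
    by (intro emeasure_bind[where N=borel]) (auto simp: sets_eq_imp_space_eq[OF sets_kiter])
  finally show ?thesis using assms by (simp add: emeasure_kiter)
qed

end

section \<open>Small sets, irreducibility and aperiodicity\<close>

locale ball_minorized_chain = markov_kernel K
  for K :: "'a::euclidean_space \<Rightarrow> 'a measure" +
  fixes \<pi> :: "'a measure"
  assumes prob_Pi: "prob_space \<pi>" and sets_Pi [simp, measurable_cong]: "sets \<pi> = sets borel"
    and invariant: "\<pi> \<bind> K = \<pi>"
    and AE_Pi_iff: "\<And>P. (AE x in \<pi>. P x) \<longleftrightarrow> (AE x in lborel. P x)"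
    and minorization: "\<And>r. r > 0 \<Longrightarrow> \<exists>c>0. \<forall>x\<in>cball 0 r. \<forall>A\<in>sets borel. A \<subseteq> cball 0 r \<longrightarrow>
           ennreal c * emeasure lborel A \<le> emeasure (K x) A"
begin

lemma space_Pi [simp]: "space \<pi> = UNIV"
  using sets_eq_imp_space_eq[OF sets_Pi] by simp

text \<open>Intersecting with the ball turns the bound on its subsets into an inequality of
  measures, the form in which integrals can be compared. The order on measures looks at all sets; on
  non-Borel ones both sides are 0.\<close>

lemma ball_minorization:
  assumes "r > 0"
  obtains c where "c > 0" "\<And>x. x \<in> cball 0 r \<Longrightarrow> ball_lebesgue c r \<le> K x"
proof -
  obtain c where c: "c > 0" and *: "\<And>x A. x \<in> cball 0 r \<Longrightarrow> A \<in> sets borel \<Longrightarrow> A \<subseteq> cball 0 r \<Longrightarrow>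
      ennreal c * emeasure lborel A \<le> emeasure (K x) A"
    using minorization[OF assms] by blast
  have "ball_lebesgue c r \<le> K x" if "x \<in> cball 0 r" for x
  proof -
    have "emeasure (ball_lebesgue c r) A \<le> emeasure (K x) A" for A
    proof (cases "A \<in> sets borel")
      case True
      then have "emeasure (ball_lebesgue c r) A \<le> emeasure (K x) (A \<inter> cball 0 r)"
        using *[OF that, of "A \<inter> cball 0 r"] by (simp add: emeasure_ball_lebesgue)
      also have "\<dots> \<le> emeasure (K x) A" using True by (intro emeasure_mono) auto
      finally show ?thesis .
    qed (simp add: emeasure_notin_sets)
    then show ?thesis by (simp add: le_measure_iff le_fun_def)
  qed
  with c that show ?thesis by blast
qed

lemma small_set_compact:
  assumes "compact C"
  shows "small_set K C"
proof -
  obtain r where r: "r > 0" "C \<subseteq> cball 0 r"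
    using compact_imp_bounded[OF assms] by (auto simp: bounded_pos subset_iff)
  obtain c where c: "c > 0" "\<And>x. x \<in> cball 0 r \<Longrightarrow> ball_lebesgue c r \<le> K x"
    using ball_minorization[OF r(1)] by blast
  have "emeasure (ball_lebesgue c r) (UNIV :: 'a set) \<noteq> 0"
    using c(1) emeasure_lborel_cball_pos[OF r(1), of "0::'a"]
    by (simp add: emeasure_ball_lebesgue)
  moreover have "emeasure (ball_lebesgue c r) A \<le> kpow K 1 x A" if "x \<in> C" "A \<in> sets borel" for x A
  proof -
    have "emeasure (ball_lebesgue c r) A \<le> emeasure (K x) A"
      using c(2)[of x] r(2) that by (auto intro!: le_measureD3)
    then show ?thesis using that(2) by simp
  qed
  ultimately show ?thesis
    unfolding small_set_def
    by (intro exI[of _ 1] conjI exI[of _ "ball_lebesgue c r"]) auto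
qed

lemma irreducibility_lborel: "irreducibility_measure K lborel"
  unfolding irreducibility_measure_def
proof (intro conjI ballI impI allI)
  fix A :: "'a set" and x :: 'a assume A: "A \<in> sets borel" "emeasure lborel A > 0"
  have "\<exists>n. emeasure lborel (A \<inter> cball 0 (real n)) \<noteq> 0"
  proof (rule ccontr)
    assume "\<not> ?thesis"
    then have "emeasure lborel (\<Union>n. A \<inter> cball 0 (real n)) = 0"
      using A by (intro emeasure_UN_eq_0) auto
    moreover have "(\<Union>n. A \<inter> cball 0 (real n)) = A" by (auto simp: real_arch_simple)
    ultimately show False using A by simp
  qed
  then obtain n where n: "emeasure lborel (A \<inter> cball 0 (real n)) \<noteq> 0" by blast
  \<comment> \<open>This ball contains the start as well as a nonnull part of \<open>A\<close>, so a
    single step suffices.\<close>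
  define r where "r = real n + norm x + 1"
  have r: "r > 0" "x \<in> cball 0 r" by (auto simp: r_def add_nonneg_pos)
  obtain c where c: "c > 0" "\<And>x. x \<in> cball 0 r \<Longrightarrow> ball_lebesgue c r \<le> K x"
    using ball_minorization[OF r(1)] by blast
  have "emeasure lborel (A \<inter> cball 0 (real n)) \<le> emeasure lborel (A \<inter> cball 0 r)"
    using A by (intro emeasure_mono) (auto simp: r_def add_increasing2)
  then have "0 < emeasure lborel (A \<inter> cball 0 r)" using n by (metis not_gr_zero le_zero_eq)
  then have "0 < emeasure (ball_lebesgue c r) A"
    using A c(1) by (simp add: emeasure_ball_lebesgue ennreal_zero_less_mult_iff)
  also have "\<dots> \<le> emeasure (K x) A" using c(2)[OF r(2)] by (intro le_measureD3) auto
  also have "\<dots> = kpow K 1 x A" using A by simp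
  finally show "\<exists>m\<ge>1. kpow K m x A > 0" by (intro exI[of _ 1]) auto
qed simp_all

lemma irreducible: "irreducible K"
  unfolding irreducible_def using irreducibility_lborel by blast

text \<open>In accessibility the number of steps depends on the starting point. There are only
  countably many step numbers, so one of them works on a nonnull part of the ball.\<close>

lemma accessible_imp_integral_cball_pos:
  assumes "accessible K A" "r > 0"
  obtains k where "k \<ge> 1" "(\<integral>\<^sup>+y. indicator (cball 0 r) y * kpow K k y A \<partial>lborel) > 0"
proof -
  have A [measurable]: "A \<in> sets borel" and acc: "\<And>x. \<exists>m\<ge>1. kpow K m x A > 0"
    using assms(1) by (auto simp: accessible_def)
  have "\<exists>k\<ge>1. (\<integral>\<^sup>+y. indicator (cball 0 r) y * kpow K k y A \<partial>lborel) \<noteq> 0"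
  proof (rule ccontr)
    assume "\<not> ?thesis"
    then have "AE y in lborel. indicator (cball 0 r) y * kpow K k y A = 0" if "k \<ge> 1" for k
    proof -
      have "(\<lambda>y. indicator (cball 0 r) y * kpow K k y A) \<in> borel_measurable lborel" by measurable
      from nn_integral_0_iff_AE[OF this] show ?thesis
        using \<open>\<not> _\<close> that by auto
    qed
    then have "AE y in lborel. \<forall>k. k \<ge> 1 \<longrightarrow> indicator (cball 0 r) y * kpow K k y A = 0"
      unfolding AE_all_countable by simp
    then have "AE y in lborel. y \<notin> cball (0::'a) r"
    proof (rule eventually_mono)
      fix y assume *: "\<forall>k. k \<ge> 1 \<longrightarrow> indicator (cball 0 r) y * kpow K k y A = 0"
      obtain m where "m \<ge> 1" "kpow K m y A > 0" using acc by blast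
      then show "y \<notin> cball 0 r" using *[rule_format, of m] by auto
    qed
    then have "emeasure lborel (cball (0::'a) r) = 0"
      by (subst (asm) AE_iff_measurable[OF _ refl]) (auto simp: cball_def dist_norm)
    with emeasure_lborel_cball_pos[OF assms(2), of "0::'a"] show False by simp
  qed
  then show ?thesis using that by (auto simp: zero_less_iff_neq_zero)
qed

text \<open>An accessible small set may be unbounded, so its returns are routed through a ball: the
  minorizing measure leads into the ball and the ball leads back to \<open>C\<close>. Lingering in
  the ball for one extra step gives a second return time, the successor of the first.\<close>

lemma aperiodic: "aperiodic K"
  unfolding aperiodic_def
proof (intro conjI irreducible allI impI)
  fix C :: "'a set" assume "small_set K C \<and> accessible K C"
  then have acc: "accessible K C" and small: "small_set K C" by auto
  then have C [measurable]: "C \<in> sets borel" by (simp add: accessible_def)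
  obtain m \<mu> where m: "m \<ge> 1" and sets_mu [simp, measurable_cong]: "sets \<mu> = sets borel"
    and mu: "emeasure \<mu> (space \<mu>) \<noteq> 0"
    and le: "\<And>x A. x \<in> C \<Longrightarrow> A \<in> sets borel \<Longrightarrow> emeasure \<mu> A \<le> kpow K m x A"
    using small unfolding small_set_def by blast
  have [simp]: "space \<mu> = UNIV" using sets_eq_imp_space_eq[OF sets_mu] by simp
  have "\<exists>n. emeasure \<mu> (cball 0 (real n)) \<noteq> 0"
  proof (rule ccontr)
    assume "\<not> ?thesis"
    then have "emeasure \<mu> (\<Union>n. cball 0 (real n)) = 0" by (intro emeasure_UN_eq_0) auto
    moreover have "(\<Union>n. cball 0 (real n)) = (UNIV :: 'a set)" by (auto simp: real_arch_simple)
    ultimately show False using mu by simp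
  qed
  then obtain n where n: "emeasure \<mu> (cball 0 (real n)) \<noteq> 0" by blast
  define r where "r = real n + 1"
  have r: "r > 0" by (simp add: r_def)
  have "emeasure \<mu> (cball 0 (real n)) \<le> emeasure \<mu> (cball 0 r)"
    by (intro emeasure_mono) (auto simp: r_def)
  with n have mu_r: "0 < emeasure \<mu> (cball 0 r)" by (metis not_gr_zero le_zero_eq)
  obtain c where c: "c > 0" "\<And>x. x \<in> cball 0 r \<Longrightarrow> ball_lebesgue c r \<le> K x"
    using ball_minorization[OF r] by blast
  obtain k where k: "k \<ge> 1" "(\<integral>\<^sup>+y. indicator (cball 0 r) y * kpow K k y C \<partial>lborel) > 0"
    using accessible_imp_integral_cball_pos[OF acc r] by blast
  define s where "s = (\<integral>\<^sup>+y. kpow K k y C \<partial>ball_lebesgue c r)"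
  have "s = (\<integral>\<^sup>+y. ennreal c * (indicator (cball 0 r) y * kpow K k y C) \<partial>lborel)"
    unfolding s_def ball_lebesgue_def
    by (subst nn_integral_density) (measurable, simp add: mult.assoc)
  then have "s = ennreal c * (\<integral>\<^sup>+y. indicator (cball 0 r) y * kpow K k y C \<partial>lborel)"
    by (simp add: nn_integral_cmult)
  with k c(1) have s: "s > 0" by (simp add: ennreal_zero_less_mult_iff)
  define b where "b = emeasure (ball_lebesgue c r) (cball (0::'a) r)"
  have b: "b > 0" using c(1) emeasure_lborel_cball_pos[OF r, of "0::'a"]
    by (simp add: b_def emeasure_ball_lebesgue ennreal_zero_less_mult_iff)
  have step1: "s \<le> kpow K (Suc k) y C" if "y \<in> cball 0 r" for y
    unfolding s_def using nn_integral_ball_lebesgue_le[OF c(2)[OF that]] by simp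
  \<comment> \<open>The extra step from the ball to itself costs only the factor
    \<open>b\<close>.\<close>
  have step2: "s * b \<le> kpow K (Suc (Suc k)) y C" if "y \<in> cball 0 r" for y
  proof -
    have "s * b = (\<integral>\<^sup>+z. s * indicator (cball (0::'a) r) z \<partial>ball_lebesgue c r)"
      by (simp add: b_def nn_integral_cmult_indicator)
    also have "\<dots> \<le> (\<integral>\<^sup>+z. kpow K (Suc k) z C \<partial>ball_lebesgue c r)"
      using step1 by (intro nn_integral_mono) (auto simp: indicator_def simp del: kpow.simps)
    also have "\<dots> \<le> kpow K (Suc (Suc k)) y C"
      using nn_integral_ball_lebesgue_le[OF c(2)[OF that]] by simp
    finally show ?thesis .
  qed
  \<comment> \<open>The mass that reaches the ball after \<open>m\<close> steps is at least
    \<open>\<mu>\<close> of the ball, whatever the start in \<open>C\<close>, so the bound survives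
    the infimum.\<close>
  have step3: "(INF x\<in>C. kpow K (m + j) x C) > 0"
    if a: "a > 0" and le_a: "\<And>y. y \<in> cball 0 r \<Longrightarrow> a \<le> kpow K j y C" for a j
  proof -
    have "a * emeasure \<mu> (cball 0 r) \<le> kpow K (m + j) x C" if "x \<in> C" for x
    proof -
      have "a * emeasure \<mu> (cball 0 r) \<le> a * emeasure (kiter K m x) (cball 0 r)"
        using le[OF that] by (intro mult_left_mono) (auto simp: emeasure_kiter)
      also have "\<dots> = (\<integral>\<^sup>+y. a * indicator (cball 0 r) y \<partial>kiter K m x)"
        by (simp add: nn_integral_cmult_indicator)
      also have "\<dots> \<le> (\<integral>\<^sup>+y. kpow K j y C \<partial>kiter K m x)"
        using le_a by (intro nn_integral_mono) (auto simp: indicator_def)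
      finally show ?thesis by (simp add: kpow_add)
    qed
    then have "a * emeasure \<mu> (cball 0 r) \<le> (INF x\<in>C. kpow K (m + j) x C)"
      by (intro INF_greatest) auto
    moreover have "0 < a * emeasure \<mu> (cball 0 r)" using a mu_r by (simp add: ennreal_zero_less_mult_iff)
    ultimately show ?thesis by (rule order.strict_trans2[rotated])
  qed
  have "small_set_period K C dvd m + Suc k" "small_set_period K C dvd m + Suc (Suc k)"
    unfolding small_set_period_def
    using step3[OF s, of "Suc k"] step1 step3[of "s * b" "Suc (Suc k)"] step2 s b m
    by (auto intro!: Gcd_dvd simp: ennreal_zero_less_mult_iff simp del: kpow.simps)
  then have "small_set_period K C dvd (m + Suc (Suc k)) - (m + Suc k)" by (rule dvd_diff_nat[rotated])
  then show "small_set_period K C = 1" by simp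
qed

end

section \<open>Product measures and two independent copies of the chain\<close>

lemma integral_mono_le_measure:
  fixes f :: "'a \<Rightarrow> real"
  assumes "M \<le> N" and sets: "sets M = sets N" and f: "integrable N f" and nn: "\<And>x. 0 \<le> f x"
  shows "(\<integral>x. f x \<partial>M) \<le> (\<integral>x. f x \<partial>N)"
proof -
  have [measurable]: "f \<in> borel_measurable N" using f by auto
  then have "f \<in> borel_measurable M" using sets by (simp cong: measurable_cong_sets)
  then have "(\<integral>x. f x \<partial>M) = enn2real (\<integral>\<^sup>+x. f x \<partial>M)" using nn by (intro integral_eq_nn_integral) auto
  also have "\<dots> \<le> enn2real (\<integral>\<^sup>+x. f x \<partial>N)"
    using nn_integral_mono_measure[OF sets \<open>M \<le> N\<close>, of f] f nn
    by (intro enn2real_mono) (auto simp: integrable_iff_bounded)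
  also have "\<dots> = (\<integral>x. f x \<partial>N)" using nn by (intro integral_eq_nn_integral[symmetric]) auto
  finally show ?thesis .
qed

lemma pair_measure_mono:
  assumes "M \<le> M'" "N \<le> N'" and sets: "sets M = sets M'" "sets N = sets N'"
    and "sigma_finite_measure N" "sigma_finite_measure N'"
  shows "M \<Otimes>\<^sub>M N \<le> M' \<Otimes>\<^sub>M N'"
proof -
  interpret N: sigma_finite_measure N by fact
  interpret N': sigma_finite_measure N' by fact
  have s: "sets (M \<Otimes>\<^sub>M N) = sets (M' \<Otimes>\<^sub>M N')" using sets by (rule sets_pair_measure_cong)
  have "emeasure (M \<Otimes>\<^sub>M N) A \<le> emeasure (M' \<Otimes>\<^sub>M N') A" for A
  proof (cases "A \<in> sets (M \<Otimes>\<^sub>M N)")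
    case True
    have "emeasure (M \<Otimes>\<^sub>M N) A = (\<integral>\<^sup>+x. emeasure N (Pair x -` A) \<partial>M)"
      using True by (rule N.emeasure_pair_measure_alt)
    also have "\<dots> \<le> (\<integral>\<^sup>+x. emeasure N' (Pair x -` A) \<partial>M)"
      by (intro nn_integral_mono le_measureD3 assms)
    also have "\<dots> \<le> (\<integral>\<^sup>+x. emeasure N' (Pair x -` A) \<partial>M')"
      by (intro nn_integral_mono_measure assms)
    also have "\<dots> = emeasure (M' \<Otimes>\<^sub>M N') A"
      using True unfolding s by (rule N'.emeasure_pair_measure_alt[symmetric])
    finally show ?thesis .
  qed (simp add: emeasure_notin_sets)
  then show ?thesis
    unfolding le_measure_iff if_P[OF sets_eq_imp_space_eq[OF s]] if_P[OF s] by (simp add: le_fun_def)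
qed

definition pair_kernel :: "('a \<Rightarrow> 'b measure) \<Rightarrow> 'a \<times> 'a \<Rightarrow> ('b \<times> 'b) measure" where
  "pair_kernel K z = K (fst z) \<Otimes>\<^sub>M K (snd z)"

text \<open>Bounds the total variation distance between the laws after \<open>n\<close> steps from the two components
  of \<open>z\<close>. Removing the mass \<open>\<nu> \<Otimes>\<^sub>M \<nu>\<close> is legitimate because it is invariant
  under exchanging the two coordinates.\<close>
primrec coupling_defect :: "('a \<Rightarrow> 'a measure) \<Rightarrow> 'a set \<Rightarrow> 'a measure \<Rightarrow> nat \<Rightarrow> 'a \<times> 'a \<Rightarrow> real" where
  "coupling_defect K B \<nu> 0 z = 1"
| "coupling_defect K B \<nu> (Suc n) z = (\<integral>w. coupling_defect K B \<nu> n w \<partial>pair_kernel K z)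
     - indicator (B \<times> B) z * (\<integral>w. coupling_defect K B \<nu> n w \<partial>(\<nu> \<Otimes>\<^sub>M \<nu>))"

lemma emeasure_pair_Times:
  assumes "finite_measure M" "finite_measure N" "A \<in> sets M" "B \<in> sets N"
  shows "emeasure (M \<Otimes>\<^sub>M N) (A \<times> B) = emeasure M A * emeasure N B"
  using assms by (intro sigma_finite_measure.emeasure_pair_measure_Times finite_measure.sigma_finite_measure)

lemma finite_measure_pair:
  assumes "finite_measure M" "finite_measure N"
  shows "finite_measure (M \<Otimes>\<^sub>M N)"
  using assms by (intro finite_measureI)
    (simp add: space_pair_measure emeasure_pair_Times ennreal_mult_eq_top_iff finite_measure.emeasure_finite)

lemma integral_pair_fst_minus_snd:
  fixes g :: "'a \<Rightarrow> real"
  assumes "prob_space M" "prob_space N" "sets M = sets N"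
    and g: "g \<in> borel_measurable M" and bd: "\<And>x. \<bar>g x\<bar> \<le> B"
  shows "(\<integral>w. g (fst w) - g (snd w) \<partial>(M \<Otimes>\<^sub>M N)) = (\<integral>x. g x \<partial>M) - (\<integral>x. g x \<partial>N)"
proof -
  interpret M: prob_space M by fact
  interpret N: prob_space N by fact
  interpret pair_prob_space M N ..
  have [measurable]: "g \<in> borel_measurable M" "g \<in> borel_measurable N"
    using g assms(3) by (auto cong: measurable_cong_sets)
  have i1: "integrable (M \<Otimes>\<^sub>M N) (\<lambda>w. g (fst w))" and i2: "integrable (M \<Otimes>\<^sub>M N) (\<lambda>w. g (snd w))"
    using bd by (auto intro!: P.integrable_const_bound[where B=B])
  have "(\<integral>w. g (fst w) \<partial>(M \<Otimes>\<^sub>M N)) = (\<integral>x. \<integral>y. g x \<partial>N \<partial>M)"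
    using integral_fst'[OF i1] by simp
  moreover have "(\<integral>w. g (snd w) \<partial>(M \<Otimes>\<^sub>M N)) = (\<integral>x. \<integral>y. g y \<partial>N \<partial>M)"
    using integral_fst'[OF i2] by simp
  ultimately show ?thesis using i1 i2 by (simp add: M.prob_space N.prob_space)
qed

text \<open>Exchanging the factors preserves the measure and reverses the sign of the integrand, so
  the integral equals its own negative. This makes the mass removed by the coupling invisible to
  differences of the two marginals.\<close>

lemma integral_square_antisym:
  fixes g :: "'a \<Rightarrow> real"
  assumes "finite_measure M" and g [measurable]: "g \<in> borel_measurable M"
  shows "(\<integral>w. g (fst w) - g (snd w) \<partial>(M \<Otimes>\<^sub>M M)) = 0"
proof -
  interpret M: finite_measure M by fact
  interpret pair_sigma_finite M M ..
  have "(\<integral>w. g (fst w) - g (snd w) \<partial>(M \<Otimes>\<^sub>M M)) = (\<integral>(x, y). g y - g x \<partial>(M \<Otimes>\<^sub>M M))"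
    by (subst integral_product_swap[symmetric]) (auto simp: case_prod_beta)
  also have "\<dots> = - (\<integral>w. g (fst w) - g (snd w) \<partial>(M \<Otimes>\<^sub>M M))"
    by (subst integral_minus[symmetric]) (auto simp: case_prod_beta intro!: Bochner_Integration.integral_cong)
  finally show ?thesis by simp
qed

context markov_kernel
begin

lemma finite_kernel: "finite_measure (K x)"
  using prob_kernel by (rule prob_space.finite_measure)

lemma integral_kiter_Suc:
  assumes A [measurable]: "A \<in> sets borel"
  shows "(\<integral>y. measure (kiter K n y) A \<partial>K x) = measure (kiter K (Suc n) x) A"
proof -
  have m: "(\<lambda>y. measure (kiter K n y) A) \<in> borel_measurable (K x)" by measurable
  have "(\<integral>y. measure (kiter K n y) A \<partial>K x) = enn2real (\<integral>\<^sup>+y. ennreal (measure (kiter K n y) A) \<partial>K x)"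
    by (intro integral_eq_nn_integral m) auto
  also have "\<dots> = enn2real (kpow K (Suc n) x A)" using A by (simp add: kpow_eq_measure)
  also have "\<dots> = measure (kiter K (Suc n) x) A" using A by (simp add: kpow_eq_measure del: kpow.simps)
  finally show ?thesis .
qed

end

context ball_minorized_chain
begin

lemma sets_pair_kernel [simp, measurable_cong]: "sets (pair_kernel K z) = sets borel"
  unfolding pair_kernel_def borel_prod[symmetric] by (intro sets_pair_measure_cong) auto

lemma prob_pair_kernel: "prob_space (pair_kernel K z)"
proof -
  interpret pair_prob_space "K (fst z)" "K (snd z)"
    by (intro pair_prob_space.intro pair_sigma_finite.intro prob_kernel prob_space_imp_sigma_finite)
  show ?thesis unfolding pair_kernel_def by (rule P.prob_space_axioms)
qed

lemma measurable_pair_kernel [measurable]: "pair_kernel K \<in> borel \<rightarrow>\<^sub>M subprob_algebra borel"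
proof -
  have "(\<lambda>z. K (fst z) \<Otimes>\<^sub>M K (snd z)) \<in> borel \<Otimes>\<^sub>M borel \<rightarrow>\<^sub>M subprob_algebra (borel \<Otimes>\<^sub>M borel)"
    by (intro measurable_pair_measure) measurable
  then show ?thesis by (simp add: pair_kernel_def[abs_def] borel_prod)
qed

text \<open>Rectangles determine the measure, and on a rectangle the two coordinates integrate
  separately, each by invariance of \<open>\<pi>\<close>.\<close>

lemma Pi_pair_invariant: "(\<pi> \<Otimes>\<^sub>M \<pi>) \<bind> pair_kernel K = \<pi> \<Otimes>\<^sub>M \<pi>"
proof (rule sym, rule pair_measure_eqI)
  have fin: "finite_measure \<pi>" using prob_Pi by (rule prob_space.finite_measure)
  show sf: "sigma_finite_measure \<pi>" "sigma_finite_measure \<pi>"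
    using fin by (auto intro: finite_measure.sigma_finite_measure)
  have b: "sets (\<pi> \<Otimes>\<^sub>M \<pi>) = sets borel"
    unfolding borel_prod[symmetric] by (intro sets_pair_measure_cong) auto
  then have [measurable_cong]: "sets (\<pi> \<Otimes>\<^sub>M \<pi>) = sets borel" .
  have K2: "pair_kernel K \<in> (\<pi> \<Otimes>\<^sub>M \<pi>) \<rightarrow>\<^sub>M subprob_algebra borel" by measurable
  show "sets (\<pi> \<Otimes>\<^sub>M \<pi>) = sets ((\<pi> \<Otimes>\<^sub>M \<pi>) \<bind> pair_kernel K)"
    using b by (subst sets_bind[where N=borel]) (auto simp: space_pair_measure)
  fix A B assume AB: "A \<in> sets \<pi>" "B \<in> sets \<pi>"
  from AB have AB' [measurable]: "A \<in> sets borel" "B \<in> sets borel" by auto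
  have AxB: "A \<times> B \<in> sets (borel :: ('a \<times> 'a) measure)"
    unfolding borel_prod[symmetric] using AB by auto
  have m1 [measurable]: "(\<lambda>x. emeasure (K x) A) \<in> borel_measurable \<pi>"
    and m2 [measurable]: "(\<lambda>x. emeasure (K x) B) \<in> borel_measurable \<pi>"
    using measurable_emeasure_kernel[OF kernel_subprob AB'(1)] measurable_emeasure_kernel[OF kernel_subprob AB'(2)]
    by (auto cong: measurable_cong_sets)
  have inv: "(\<integral>\<^sup>+x. emeasure (K x) A \<partial>\<pi>) = emeasure \<pi> A" if "A \<in> sets borel" for A
  proof -
    have "emeasure (\<pi> \<bind> K) A = (\<integral>\<^sup>+x. emeasure (K x) A \<partial>\<pi>)"
      using that by (intro emeasure_bind[where N=borel]) auto
    then show ?thesis by (simp add: invariant)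
  qed
  have "emeasure ((\<pi> \<Otimes>\<^sub>M \<pi>) \<bind> pair_kernel K) (A \<times> B)
      = (\<integral>\<^sup>+z. emeasure (pair_kernel K z) (A \<times> B) \<partial>(\<pi> \<Otimes>\<^sub>M \<pi>))"
    using AxB K2 by (intro emeasure_bind[where N=borel]) (auto simp: space_pair_measure)
  also have "\<dots> = (\<integral>\<^sup>+z. emeasure (K (fst z)) A * emeasure (K (snd z)) B \<partial>(\<pi> \<Otimes>\<^sub>M \<pi>))"
    using AB unfolding pair_kernel_def by (simp add: emeasure_pair_Times finite_kernel)
  also have "\<dots> = (\<integral>\<^sup>+x. \<integral>\<^sup>+y. emeasure (K x) A * emeasure (K y) B \<partial>\<pi> \<partial>\<pi>)"
    by (subst sigma_finite_measure.nn_integral_fst[OF sf(1), symmetric]) (intro borel_measurable_times_ennreal measurable_compose[OF measurable_fst m1] measurable_compose[OF measurable_snd m2], simp)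
  also have "\<dots> = (\<integral>\<^sup>+x. emeasure (K x) A * emeasure \<pi> B \<partial>\<pi>)"
    by (simp add: nn_integral_cmult inv)
  also have "\<dots> = emeasure \<pi> A * emeasure \<pi> B"
    by (simp add: nn_integral_multc inv)
  finally show "emeasure \<pi> A * emeasure \<pi> B = emeasure ((\<pi> \<Otimes>\<^sub>M \<pi>) \<bind> pair_kernel K) (A \<times> B)" ..
qed

lemma finite_Pi: "finite_measure \<pi>"
  using prob_Pi by (rule prob_space.finite_measure)

text \<open>Iterated invariance, in real-valued form so that \<open>\<pi>\<close> of a set can be
  subtracted under an integral as an average of n-step probabilities.\<close>

lemma integral_Pi_measure_kiter:
  assumes [measurable]: "A \<in> sets borel"
  shows "(\<integral>y. measure (kiter K n y) A \<partial>\<pi>) = measure \<pi> A"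
proof -
  have "(\<integral>\<^sup>+y. kpow K n y A \<partial>\<pi>) = emeasure \<pi> A"
  proof (induction n)
    case (Suc n)
    have "(\<integral>\<^sup>+y. kpow K n y A \<partial>(\<pi> \<bind> K)) = (\<integral>\<^sup>+y. kpow K (Suc n) y A \<partial>\<pi>)"
      using kpow_measurable[OF assms, of n] by (subst nn_integral_bind[where B=borel]) auto
    then show ?case by (simp only: invariant Suc)
  qed (simp add: assms)
  moreover have "(\<integral>y. measure (kiter K n y) A \<partial>\<pi>) = enn2real (\<integral>\<^sup>+y. kpow K n y A \<partial>\<pi>)"
    unfolding kpow_eq_measure[OF assms] by (rule integral_eq_nn_integral) measurable
  ultimately show ?thesis by (simp add: measure_def)
qed

section \<open>The surviving mass of the coupling and its limit\<close>

context
  fixes c :: real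
  assumes c: "c > 0" and minor: "\<And>x. x \<in> cball 0 1 \<Longrightarrow> ball_lebesgue c 1 \<le> K x"
begin

private abbreviation "\<nu> \<equiv> ball_lebesgue c 1 :: 'a measure"

private abbreviation "u \<equiv> coupling_defect K (cball 0 1) \<nu>"

lemma finite_nu: "finite_measure \<nu>"
  by (rule finite_measure_ball_lebesgue)

lemma sets_nu2 [simp, measurable_cong]: "sets (\<nu> \<Otimes>\<^sub>M \<nu>) = sets borel"
  unfolding borel_prod[symmetric] by (intro sets_pair_measure_cong) auto

lemma square_measurable [measurable]: "cball 0 1 \<times> cball 0 1 \<in> sets (borel :: ('a \<times> 'a) measure)"
  unfolding borel_prod[symmetric] by (intro pair_measureI) auto

lemma nu2_le: "z \<in> cball 0 1 \<times> cball 0 1 \<Longrightarrow> \<nu> \<Otimes>\<^sub>M \<nu> \<le> pair_kernel K z"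
  unfolding pair_kernel_def using minor
  by (intro pair_measure_mono finite_measure.sigma_finite_measure finite_nu finite_kernel)
     auto

lemma measurable_defect [measurable]: "u n \<in> borel_measurable borel"
proof (induction n)
  case (Suc n)
  then have [measurable]: "u n \<in> borel_measurable borel" .
  have "(\<lambda>z. \<integral>w. u n w \<partial>pair_kernel K z) \<in> borel_measurable borel"
    using measurable_compose[OF measurable_pair_kernel integral_measurable_subprob_algebra[OF Suc]] .
  moreover have "u (Suc n) = (\<lambda>z. (\<integral>w. u n w \<partial>pair_kernel K z)
     - indicator (cball 0 1 \<times> cball 0 1) z * (\<integral>w. u n w \<partial>(\<nu> \<Otimes>\<^sub>M \<nu>)))"
    by (simp add: fun_eq_iff)
  ultimately show ?case by simp
qed (simp add: coupling_defect.simps(1)[abs_def])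

lemma integrable_pair_kernel:
  "f \<in> borel_measurable borel \<Longrightarrow> (\<And>z. \<bar>f z\<bar> \<le> B) \<Longrightarrow> integrable (pair_kernel K z) (f :: _ \<Rightarrow> real)"
  using prob_space.finite_measure[OF prob_pair_kernel, of z]
  by (intro finite_measure.integrable_const_bound[where B=B]) auto

lemma integrable_nu2:
  "f \<in> borel_measurable borel \<Longrightarrow> (\<And>z. \<bar>f z\<bar> \<le> B) \<Longrightarrow> integrable (\<nu> \<Otimes>\<^sub>M \<nu>) (f :: _ \<Rightarrow> real)"
  using finite_measure_pair[OF finite_nu finite_nu]
  by (intro finite_measure.integrable_const_bound[where B=B]) auto

text \<open>On the unit square \<open>pair_kernel K z\<close> dominates
  \<open>\<nu> \<Otimes>\<^sub>M \<nu>\<close>, so what remains after the removal is a positive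
  operator. Bounds, monotonicity and the domination of marginal differences all apply this to
  different nonnegative functions.\<close>

lemma integral_nu2_le:
  fixes f :: "_ \<Rightarrow> real"
  assumes "f \<in> borel_measurable borel" "\<And>z. 0 \<le> f z" "\<And>z. f z \<le> B"
  shows "indicator (cball 0 1 \<times> cball 0 1) z * (\<integral>w. f w \<partial>(\<nu> \<Otimes>\<^sub>M \<nu>)) \<le> (\<integral>w. f w \<partial>pair_kernel K z)"
proof (cases "z \<in> cball 0 1 \<times> cball 0 1")
  case True
  then have "indicator (cball 0 1 \<times> cball 0 1) z = (1::real)" by (rule indicator_simps(1))
  moreover have "\<bar>f w\<bar> \<le> B" for w using assms(2)[of w] assms(3)[of w] by linarith
  then have "(\<integral>w. f w \<partial>(\<nu> \<Otimes>\<^sub>M \<nu>)) \<le> (\<integral>w. f w \<partial>pair_kernel K z)"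
    by (intro integral_mono_le_measure nu2_le True integrable_pair_kernel[OF assms(1)] assms(2)) (simp only: sets_nu2 sets_pair_kernel)
  ultimately show ?thesis by simp
next
  case False
  then have "indicator (cball 0 1 \<times> cball 0 1) z = (0::real)" by (rule indicator_simps(2))
  then show ?thesis using assms(2) by simp
qed

lemma defect_bounds: "0 \<le> u n z \<and> u n z \<le> 1"
proof (induction n arbitrary: z)
  case (Suc n)
  have "(\<integral>w. u n w \<partial>pair_kernel K z) \<le> (\<integral>w. 1 \<partial>pair_kernel K z)"
    using Suc by (intro integral_mono integrable_pair_kernel[where B=1]) auto
  also have "\<dots> = 1" using prob_space.prob_space[OF prob_pair_kernel] by simp
  finally have *: "(\<integral>w. u n w \<partial>pair_kernel K z) \<le> 1" .
  have "0 \<le> (\<integral>w. u n w \<partial>(\<nu> \<Otimes>\<^sub>M \<nu>))" using Suc by simp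
  then have "0 \<le> indicator (cball 0 1 \<times> cball 0 1) z * (\<integral>w. u n w \<partial>(\<nu> \<Otimes>\<^sub>M \<nu>))" by simp
  moreover have "indicator (cball 0 1 \<times> cball 0 1) z * (\<integral>w. u n w \<partial>(\<nu> \<Otimes>\<^sub>M \<nu>)) \<le> (\<integral>w. u n w \<partial>pair_kernel K z)"
    using Suc by (intro integral_nu2_le[where B=1]) auto
  ultimately show ?case using * by simp
qed simp

lemma abs_defect: "\<bar>u n z\<bar> \<le> 1"
  using defect_bounds[of n z] by auto

text \<open>The first step does not raise the constant 1, and the positive operator preserves the
  inequality.\<close>

lemma defect_Suc_le: "u (Suc n) z \<le> u n z"
proof (induction n arbitrary: z)
  case 0
  then show ?case using defect_bounds[of "Suc 0" z] by simp
next
  case (Suc n)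
  have "indicator (cball 0 1 \<times> cball 0 1) z * (\<integral>w. u n w - u (Suc n) w \<partial>(\<nu> \<Otimes>\<^sub>M \<nu>))
      \<le> (\<integral>w. u n w - u (Suc n) w \<partial>pair_kernel K z)"
  proof (rule integral_nu2_le[where B=1])
    show "u n z - u (Suc n) z \<le> 1" for z using defect_bounds[of n z] defect_bounds[of "Suc n" z] by linarith
    show "0 \<le> u n z - u (Suc n) z" for z using Suc[of z] by linarith
  qed measurable
  moreover have "(\<integral>w. u n w - u (Suc n) w \<partial>pair_kernel K z)
      = (\<integral>w. u n w \<partial>pair_kernel K z) - (\<integral>w. u (Suc n) w \<partial>pair_kernel K z)"
    by (intro Bochner_Integration.integral_diff integrable_pair_kernel[OF measurable_defect abs_defect])
  moreover have "(\<integral>w. u n w - u (Suc n) w \<partial>(\<nu> \<Otimes>\<^sub>M \<nu>))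
      = (\<integral>w. u n w \<partial>(\<nu> \<Otimes>\<^sub>M \<nu>)) - (\<integral>w. u (Suc n) w \<partial>(\<nu> \<Otimes>\<^sub>M \<nu>))"
    by (intro Bochner_Integration.integral_diff integrable_nu2[OF measurable_defect abs_defect])
  ultimately show ?case
    unfolding coupling_defect.simps(2)[of _ _ _ "Suc n"] coupling_defect.simps(2)[of _ _ _ n z]
    by (simp only: right_diff_distrib)
qed

text \<open>By antisymmetry the removed term vanishes on differences of n-step probabilities, so
  they evolve under the same operator as \<open>u\<close>. Positivity applied to
  \<open>u n + ?k\<close> and to \<open>u n - ?k\<close> carries the two-sided bound to the next
  step.\<close>

lemma measure_diff_le_defect:
  assumes A [measurable]: "A \<in> sets borel"
  shows "\<bar>measure (kiter K n (fst z)) A - measure (kiter K n (snd z)) A\<bar> \<le> u n z"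
proof (induction n arbitrary: z)
  case 0
  then show ?case by (auto simp: measure_return indicator_def)
next
  case (Suc n)
  define g where "g y = measure (kiter K n y) A" for y
  have g [measurable]: "g \<in> borel_measurable borel" unfolding g_def by measurable
  have g01: "0 \<le> g y" "g y \<le> 1" for y
    unfolding g_def by (auto intro: prob_space.prob_le_1 prob_kiter)
  have gb: "\<bar>g y\<bar> \<le> 1" for y using g01[of y] by auto
  have le: "\<bar>g (fst w) - g (snd w)\<bar> \<le> u n w" for w using Suc[of w] by (simp add: g_def)
  let ?k = "\<lambda>w. g (fst w) - g (snd w)"
  have k [measurable]: "?k \<in> borel_measurable borel"
    unfolding borel_prod[symmetric] by measurable
  have kb: "\<bar>?k w\<bar> \<le> 1" for w using g01[of "fst w"] g01[of "snd w"] by auto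
  have ik: "(\<integral>w. ?k w \<partial>pair_kernel K z)
      = measure (kiter K (Suc n) (fst z)) A - measure (kiter K (Suc n) (snd z)) A"
    unfolding pair_kernel_def
    using integral_pair_fst_minus_snd[of "K (fst z)" "K (snd z)" g 1]
      integral_kiter_Suc[OF A, where n=n and x="fst z"] integral_kiter_Suc[OF A, where n=n and x="snd z"]
    by (simp add: prob_kernel gb g_def[symmetric] del: kiter.simps)
  have ik0: "(\<integral>w. ?k w \<partial>(\<nu> \<Otimes>\<^sub>M \<nu>)) = 0"
    by (rule integral_square_antisym[OF finite_nu]) measurable
  note int = integrable_pair_kernel[OF measurable_defect abs_defect] integrable_pair_kernel[OF k kb]
     integrable_nu2[OF measurable_defect abs_defect] integrable_nu2[OF k kb]
  have "indicator (cball 0 1 \<times> cball 0 1) z * (\<integral>w. u n w + ?k w \<partial>(\<nu> \<Otimes>\<^sub>M \<nu>))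
      \<le> (\<integral>w. u n w + ?k w \<partial>pair_kernel K z)"
  proof (rule integral_nu2_le[where B=2])
    show "0 \<le> u n w + ?k w" for w using le[of w] by linarith
    show "u n w + ?k w \<le> 2" for w using kb[of w] abs_defect[of n w] by linarith
  qed measurable
  moreover have "indicator (cball 0 1 \<times> cball 0 1) z * (\<integral>w. u n w - ?k w \<partial>(\<nu> \<Otimes>\<^sub>M \<nu>))
      \<le> (\<integral>w. u n w - ?k w \<partial>pair_kernel K z)"
  proof (rule integral_nu2_le[where B=2])
    show "0 \<le> u n w - ?k w" for w using le[of w] by linarith
    show "u n w - ?k w \<le> 2" for w using kb[of w] abs_defect[of n w] by linarith
  qed measurable
  ultimately show ?case
    unfolding Bochner_Integration.integral_diff[OF int(1,2)] Bochner_Integration.integral_diff[OF int(3,4)]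
      Bochner_Integration.integral_add[OF int(1,2)] Bochner_Integration.integral_add[OF int(3,4)] ik ik0
    by simp
qed

definition defect_limit :: "'a \<times> 'a \<Rightarrow> real" where
  "defect_limit z = lim (\<lambda>n. coupling_defect K (cball 0 1) \<nu> n z)"

lemma defect_tendsto: "(\<lambda>n. u n z) \<longlonglongrightarrow> defect_limit z"
proof -
  have "decseq (\<lambda>n. u n z)" using defect_Suc_le by (rule decseq_SucI)
  then have "convergent (\<lambda>n. u n z)"
    using defect_bounds by (metis convergentI decseq_convergent)
  then show ?thesis unfolding defect_limit_def by (simp add: convergent_LIMSEQ_iff)
qed

lemma defect_limit_bounds: "0 \<le> defect_limit z" "\<bar>defect_limit z\<bar> \<le> 1"
proof -
  show "0 \<le> defect_limit z"
    using defect_bounds by (intro LIMSEQ_le_const[OF defect_tendsto]) blast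
  moreover have "defect_limit z \<le> 1"
    using defect_bounds by (intro LIMSEQ_le_const2[OF defect_tendsto]) blast
  ultimately show "\<bar>defect_limit z\<bar> \<le> 1" by simp
qed

lemma measurable_defect_limit [measurable]: "defect_limit \<in> borel_measurable borel"
  by (rule borel_measurable_LIMSEQ_metric[OF measurable_defect defect_tendsto])

text \<open>The recursion passes to the limit by dominated convergence, the constant 1 being
  integrable for both finite measures.\<close>

lemma defect_limit_eq:
  "defect_limit z = (\<integral>w. defect_limit w \<partial>pair_kernel K z)
     - indicator (cball 0 1 \<times> cball 0 1) z * (\<integral>w. defect_limit w \<partial>(\<nu> \<Otimes>\<^sub>M \<nu>))"
proof (rule LIMSEQ_unique)
  show "(\<lambda>n. u (Suc n) z) \<longlonglongrightarrow> defect_limit z"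
    using defect_tendsto by (rule LIMSEQ_Suc)
  have dom: "(\<lambda>n. \<integral>w. u n w \<partial>M) \<longlonglongrightarrow> (\<integral>w. defect_limit w \<partial>M)"
    if "finite_measure M" and [measurable_cong]: "sets M = sets borel" for M
    using that abs_defect defect_tendsto
    by (intro integral_dominated_convergence[where w="\<lambda>_. 1"])
       (auto intro: finite_measure.integrable_const simp del: coupling_defect.simps)
  show "(\<lambda>n. u (Suc n) z) \<longlonglongrightarrow> (\<integral>w. defect_limit w \<partial>pair_kernel K z)
     - indicator (cball 0 1 \<times> cball 0 1) z * (\<integral>w. defect_limit w \<partial>(\<nu> \<Otimes>\<^sub>M \<nu>))"
    unfolding coupling_defect.simps
    by (intro tendsto_intros dom finite_measure_pair finite_nu prob_space.finite_measure[OF prob_pair_kernel])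
       (simp_all only: sets_nu2 sets_pair_kernel)
qed

text \<open>When the fixed-point equation is integrated over the square of \<open>\<pi>\<close>,
  invariance cancels the left side against the kernel term. What remains is the wanted integral
  times the mass of the unit square, and that mass is positive because \<open>\<pi>\<close> has the
  null sets of Lebesgue measure.\<close>

lemma integral_defect_limit_nu2: "(\<integral>w. defect_limit w \<partial>(\<nu> \<Otimes>\<^sub>M \<nu>)) = 0"
proof -
  let ?P = "\<pi> \<Otimes>\<^sub>M \<pi>" and ?D = "cball 0 1 \<times> cball 0 1 :: ('a \<times> 'a) set"
  let ?I = "\<integral>w. defect_limit w \<partial>(\<nu> \<Otimes>\<^sub>M \<nu>)"
  have sP [measurable_cong, simp]: "sets ?P = sets borel"
    unfolding borel_prod[symmetric] by (intro sets_pair_measure_cong) auto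
  have fP: "finite_measure ?P" by (intro finite_measure_pair finite_Pi)
  have mD: "(\<lambda>z. \<integral>w. defect_limit w \<partial>pair_kernel K z) \<in> borel_measurable borel"
    using measurable_compose[OF measurable_pair_kernel
        integral_measurable_subprob_algebra[OF measurable_defect_limit]] .
  have int1: "integrable ?P (\<lambda>z. \<integral>w. defect_limit w \<partial>pair_kernel K z)"
  proof (rule finite_measure.integrable_const_bound[OF fP, where B=1])
    show "(\<lambda>z. \<integral>w. defect_limit w \<partial>pair_kernel K z) \<in> borel_measurable ?P"
      using mD unfolding measurable_cong_sets[OF sP refl] .
    have "norm (\<integral>w. defect_limit w \<partial>pair_kernel K z) \<le> 1" for z
    proof -
      have "(\<integral>w. defect_limit w \<partial>pair_kernel K z) \<le> (\<integral>w. 1 \<partial>pair_kernel K z)"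
        using defect_limit_bounds
        by (intro integral_mono integrable_pair_kernel[where B=1]) (auto simp: abs_le_iff)
      also have "\<dots> = 1" using prob_space.prob_space[OF prob_pair_kernel] by simp
      moreover have "0 \<le> (\<integral>w. defect_limit w \<partial>pair_kernel K z)"
        using defect_limit_bounds by simp
      ultimately show ?thesis by simp
    qed
    then show "AE z in ?P. norm (\<integral>w. defect_limit w \<partial>pair_kernel K z) \<le> 1" by simp
  qed
  have int2: "integrable ?P (\<lambda>z. indicator ?D z * ?I)"
    using fP by (intro integrable_mult_left integrable_real_indicator)
      (auto simp: finite_measure.emeasure_finite less_top[symmetric] square_measurable)
  have "(\<integral>z. defect_limit z \<partial>?P) = (\<integral>z. (\<integral>w. defect_limit w \<partial>pair_kernel K z) - indicator ?D z * ?I \<partial>?P)"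
    by (rule Bochner_Integration.integral_cong[OF refl defect_limit_eq])
  also have "\<dots> = (\<integral>z. (\<integral>w. defect_limit w \<partial>pair_kernel K z) \<partial>?P) - measure ?P ?D * ?I"
    using int1 int2 square_measurable by (simp add: sets_eq_imp_space_eq[OF sP])
  also have "(\<integral>z. (\<integral>w. defect_limit w \<partial>pair_kernel K z) \<partial>?P) = (\<integral>z. defect_limit z \<partial>(?P \<bind> pair_kernel K))"
  proof (rule integral_bind[symmetric, where B=1 and B'=1 and K=borel])
    show "AE z in ?P. emeasure (pair_kernel K z) (space (pair_kernel K z)) \<le> ennreal 1"
      using prob_space.emeasure_space_1[OF prob_pair_kernel] by simp
    show "pair_kernel K \<in> ?P \<rightarrow>\<^sub>M subprob_algebra borel" by measurable
  qed (use fP defect_limit_bounds in auto)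
  finally have "measure ?P ?D * ?I = 0" by (simp add: Pi_pair_invariant)
  moreover have "measure ?P ?D \<noteq> 0"
  proof -
    have "emeasure \<pi> (cball 0 1) \<noteq> 0"
    proof
      assume "emeasure \<pi> (cball 0 1) = 0"
      then have "AE x in \<pi>. x \<notin> cball 0 1" by (intro AE_I[where N="cball 0 1"]) auto
      then have "AE x in lborel. x \<notin> cball (0::'a) 1" by (simp only: AE_Pi_iff)
      then have "emeasure lborel (cball (0::'a) 1) = 0"
        by (subst (asm) AE_iff_measurable[OF _ refl]) (auto simp: cball_def dist_norm)
      with emeasure_lborel_cball_pos[of 1 "0::'a"] show False by simp
    qed
    then have "emeasure ?P ?D \<noteq> 0" by (simp add: emeasure_pair_Times finite_Pi)
    then show ?thesis using fP by (simp add: finite_measure.emeasure_eq_measure)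
  qed
  ultimately show ?thesis by simp
qed

lemma defect_limit_zero_point:
  obtains z where "z \<in> cball 0 1 \<times> cball 0 1" "defect_limit z = 0"
proof -
  let ?D = "cball 0 1 \<times> cball 0 1 :: ('a \<times> 'a) set"
  have "AE w in \<nu> \<Otimes>\<^sub>M \<nu>. defect_limit w = 0"
    using integral_defect_limit_nu2 defect_limit_bounds
    by (subst (asm) integral_nonneg_eq_0_iff_AE) (auto intro: integrable_nu2[where B=1])
  then obtain N where N: "\<And>w. w \<in> space (\<nu> \<Otimes>\<^sub>M \<nu>) - N \<Longrightarrow> defect_limit w = 0" "N \<in> null_sets (\<nu> \<Otimes>\<^sub>M \<nu>)"
    using AE_E3[where M="\<nu> \<Otimes>\<^sub>M \<nu>" and P="\<lambda>w. defect_limit w = 0"] by metis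
  have "emeasure (\<nu> \<Otimes>\<^sub>M \<nu>) ?D > 0"
    using c emeasure_lborel_cball_pos[of 1 "0::'a"]
    by (simp add: emeasure_pair_Times finite_nu emeasure_ball_lebesgue ennreal_zero_less_mult_iff)
  then have "\<not> ?D \<subseteq> N"
    using N(2) emeasure_mono[of ?D N "\<nu> \<Otimes>\<^sub>M \<nu>"] by (auto simp: null_sets_def)
  then obtain z where "z \<in> ?D" "z \<notin> N" by blast
  then show ?thesis using that N(1)[of z] by (auto simp: space_pair_measure)
qed

text \<open>A single zero in the unit square is enough. There the fixed-point equation makes the
  integral under \<open>pair_kernel K z\<close> vanish, and this measure dominates Lebesgue measure,
  up to a factor, on the square of each centred ball of radius at least 1, since such a ball
  contains both components of \<open>z\<close>.\<close>

lemma AE_defect_limit: "AE x in lborel. AE y in lborel. defect_limit (x, y) = 0"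
proof -
  obtain z where z: "z \<in> cball 0 1 \<times> cball 0 1" "defect_limit z = 0"
    by (rule defect_limit_zero_point)
  have Kz: "(\<integral>w. defect_limit w \<partial>pair_kernel K z) = 0"
    using defect_limit_eq[of z] z(2) integral_defect_limit_nu2 by simp
  have *: "AE x in lborel. x \<in> cball 0 r \<longrightarrow> (AE y in lborel. y \<in> cball 0 r \<longrightarrow> defect_limit (x, y) = 0)"
    if r: "r \<ge> 1" for r :: real
  proof -
    obtain c' where c': "c' > 0" "\<And>x. x \<in> cball 0 r \<Longrightarrow> ball_lebesgue c' r \<le> K x"
      using ball_minorization[of r] r by auto
    let ?\<nu> = "ball_lebesgue c' r :: 'a measure"
    have fin: "finite_measure ?\<nu>" by (rule finite_measure_ball_lebesgue)
    have sets2 [measurable_cong, simp]: "sets (?\<nu> \<Otimes>\<^sub>M ?\<nu>) = sets borel"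
      unfolding borel_prod[symmetric] by (intro sets_pair_measure_cong) auto
    have "fst z \<in> cball 0 r" "snd z \<in> cball 0 r" using z(1) r by (auto simp: mem_Times_iff)
    then have "?\<nu> \<Otimes>\<^sub>M ?\<nu> \<le> pair_kernel K z"
      unfolding pair_kernel_def using c'(2)
      by (intro pair_measure_mono finite_measure.sigma_finite_measure fin finite_kernel) auto
    then have "(\<integral>w. defect_limit w \<partial>(?\<nu> \<Otimes>\<^sub>M ?\<nu>)) \<le> (\<integral>w. defect_limit w \<partial>pair_kernel K z)"
      using integrable_pair_kernel[OF measurable_defect_limit defect_limit_bounds(2)] defect_limit_bounds(1)
      by (intro integral_mono_le_measure) (simp_all only: sets2 sets_pair_kernel)
    moreover have "0 \<le> (\<integral>w. defect_limit w \<partial>(?\<nu> \<Otimes>\<^sub>M ?\<nu>))" using defect_limit_bounds by simp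
    ultimately have "(\<integral>w. defect_limit w \<partial>(?\<nu> \<Otimes>\<^sub>M ?\<nu>)) = 0" using Kz by simp
    moreover have "integrable (?\<nu> \<Otimes>\<^sub>M ?\<nu>) defect_limit"
      using finite_measure_pair[OF fin fin] defect_limit_bounds(2)
      by (intro finite_measure.integrable_const_bound[where B=1]) auto
    ultimately have "AE w in ?\<nu> \<Otimes>\<^sub>M ?\<nu>. defect_limit w = 0"
      using defect_limit_bounds(1) by (subst (asm) integral_nonneg_eq_0_iff_AE) auto
    then have "AE x in ?\<nu>. AE y in ?\<nu>. defect_limit (x, y) = 0"
      using fin by (intro pair_sigma_finite.AE_pair pair_sigma_finite.intro finite_measure.sigma_finite_measure)
    then show ?thesis using c'(1) by (simp only: AE_ball_lebesgue_iff)
  qed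
  have "AE x in lborel. \<forall>n. x \<in> cball 0 (real (Suc n)) \<longrightarrow>
      (AE y in lborel. y \<in> cball 0 (real (Suc n)) \<longrightarrow> defect_limit (x, y) = 0)"
    unfolding AE_all_countable by (intro allI *) simp
  then show ?thesis
  proof (rule eventually_mono)
    fix x :: 'a
    assume H: "\<forall>n. x \<in> cball 0 (real (Suc n)) \<longrightarrow>
      (AE y in lborel. y \<in> cball 0 (real (Suc n)) \<longrightarrow> defect_limit (x, y) = 0)"
    \<comment> \<open>From this radius on every ball contains \<open>x\<close>, so only the
      restriction on \<open>y\<close> is left.\<close>
    obtain n0 where n0: "norm x \<le> real n0" using real_arch_simple by blast
    have "AE y in lborel. y \<in> cball 0 (real (Suc (n0 + n))) \<longrightarrow> defect_limit (x, y) = 0" for n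
      using n0 H[rule_format, of "n0 + n"] by simp
    then have "AE y in lborel. \<forall>n. y \<in> cball 0 (real (Suc (n0 + n))) \<longrightarrow> defect_limit (x, y) = 0"
      unfolding AE_all_countable by simp
    then show "AE y in lborel. defect_limit (x, y) = 0"
    proof (rule eventually_mono)
      fix y :: 'a
      assume H: "\<forall>n. y \<in> cball 0 (real (Suc (n0 + n))) \<longrightarrow> defect_limit (x, y) = 0"
      obtain n where "norm y \<le> real n" using real_arch_simple by blast
      then show "defect_limit (x, y) = 0" using H[rule_format, of n] by simp
    qed
  qed
qed

section \<open>Convergence in total variation\<close>

lemma tv_dist_le:
  "0 \<le> tv_dist_kpow K n x \<pi> \<and> tv_dist_kpow K n x \<pi> \<le> (\<integral>y. u n (x, y) \<partial>\<pi>)"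
proof -
  have m [measurable]: "(\<lambda>y. u n (x, y)) \<in> borel_measurable \<pi>"
    by measurable
  have iu: "integrable \<pi> (\<lambda>y. u n (x, y))"
    using abs_defect m by (intro finite_measure.integrable_const_bound[OF finite_Pi, where B=1]) auto
  have le: "\<bar>enn2real (kpow K n x A) - measure \<pi> A\<bar> \<le> (\<integral>y. u n (x, y) \<partial>\<pi>)"
    if A [measurable]: "A \<in> sets borel" for A
  proof -
    interpret \<pi>: prob_space \<pi> by (rule prob_Pi)
    have ig: "integrable \<pi> (\<lambda>y. measure (kiter K n y) A)"
      by (intro \<pi>.integrable_const_bound[where B=1]) (auto intro: prob_space.prob_le_1 prob_kiter)
    \<comment> \<open>By invariance \<open>measure \<pi> A\<close> is the average of the n-step
      probabilities from \<open>y\<close>, so the error is an average of differences that the defect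
      bounds.\<close>
    have "enn2real (kpow K n x A) - measure \<pi> A
        = (\<integral>y. measure (kiter K n x) A - measure (kiter K n y) A \<partial>\<pi>)"
      using ig \<pi>.prob_space by (simp add: kpow_eq_measure integral_Pi_measure_kiter)
    also have "\<bar>\<dots>\<bar> \<le> (\<integral>y. \<bar>measure (kiter K n x) A - measure (kiter K n y) A\<bar> \<partial>\<pi>)"
      by (rule integral_abs_bound)
    also have "\<dots> \<le> (\<integral>y. u n (x, y) \<partial>\<pi>)"
      using ig measure_diff_le_defect[OF A, of n "(x, _)"]
      by (intro integral_mono iu integrable_abs Bochner_Integration.integrable_diff) auto
    finally show ?thesis .
  qed
  \<comment> \<open>The supremum is taken in the reals, so boundedness has to precede any comparison
    with one of its members; the empty set then gives nonnegativity.\<close>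
  have "bdd_above ((\<lambda>A. \<bar>enn2real (kpow K n x A) - measure \<pi> A\<bar>) ` sets borel)"
    using le by (intro bdd_aboveI2)
  then have "\<bar>enn2real (kpow K n x {}) - measure \<pi> {}\<bar> \<le> tv_dist_kpow K n x \<pi>"
    unfolding tv_dist_kpow_def by (intro cSUP_upper) auto
  then have "0 \<le> tv_dist_kpow K n x \<pi>" by (rule order_trans[OF abs_ge_zero])
  moreover have "tv_dist_kpow K n x \<pi> \<le> (\<integral>y. u n (x, y) \<partial>\<pi>)"
    unfolding tv_dist_kpow_def by (intro cSUP_least le) auto
  ultimately show ?thesis by simp
qed

lemma AE_tv_dist_tendsto_aux: "AE x in \<pi>. (\<lambda>n. tv_dist_kpow K n x \<pi>) \<longlonglongrightarrow> 0"
  unfolding AE_Pi_iff using AE_defect_limit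
proof (rule eventually_mono)
  fix x assume x: "AE y in lborel. defect_limit (x, y) = 0"
  interpret \<pi>: prob_space \<pi> by (rule prob_Pi)
  have "(\<lambda>n. \<integral>y. u n (x, y) \<partial>\<pi>) \<longlonglongrightarrow> (\<integral>y. 0 \<partial>\<pi>)"
  proof (rule integral_dominated_convergence[where w="\<lambda>_. 1"])
    show "AE y in \<pi>. (\<lambda>n. u n (x, y)) \<longlonglongrightarrow> 0"
      unfolding AE_Pi_iff using x
    proof (rule eventually_mono)
      fix y assume "defect_limit (x, y) = 0"
      then show "(\<lambda>n. u n (x, y)) \<longlonglongrightarrow> 0" using defect_tendsto[of "(x, y)"] by simp
    qed
    show "(\<lambda>y. u n (x, y)) \<in> borel_measurable \<pi>" for n
      by measurable
  qed (use abs_defect in auto)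
  then have lim: "(\<lambda>n. \<integral>y. u n (x, y) \<partial>\<pi>) \<longlonglongrightarrow> 0" by simp
  show "(\<lambda>n. tv_dist_kpow K n x \<pi>) \<longlonglongrightarrow> 0"
    by (rule tendsto_sandwich[OF _ _ tendsto_const lim])
       (intro always_eventually allI conjunct1[OF tv_dist_le] conjunct2[OF tv_dist_le])+
qed

end

lemma AE_tv_dist_tendsto: "AE x in \<pi>. (\<lambda>n. tv_dist_kpow K n x \<pi>) \<longlonglongrightarrow> 0"
proof -
  obtain c where "c > 0" "\<And>x. x \<in> cball 0 1 \<Longrightarrow> ball_lebesgue c 1 \<le> K x"
    using ball_minorization[OF zero_less_one] by blast
  then show ?thesis by (rule AE_tv_dist_tendsto_aux)
qed

section \<open>Recurrence\<close>

lemma Pi_pos_of_accessible: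
  assumes "accessible K A"
  shows "measure \<pi> A > 0"
proof (rule ccontr)
  assume "\<not> ?thesis"
  then have A0: "measure \<pi> A = 0" using measure_nonneg[of \<pi> A] by linarith
  have A [measurable]: "A \<in> sets borel" using assms by (simp add: accessible_def)
  \<comment> \<open>The average over \<open>\<pi>\<close> of these nonnegative numbers is
    \<open>measure \<pi> A\<close>, which is 0 for every \<open>n\<close>; the countably many
    exceptional sets can be joined.\<close>
  have "AE y in \<pi>. kpow K n y A = 0" for n
  proof -
    have "integrable \<pi> (\<lambda>y. measure (kiter K n y) A)"
      using finite_Pi by (intro finite_measure.integrable_const_bound[where B=1])
        (auto intro: prob_space.prob_le_1 prob_kiter)
    moreover have "(\<integral>y. measure (kiter K n y) A \<partial>\<pi>) = 0"
      using integral_Pi_measure_kiter[OF A] A0 by simp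
    ultimately have "AE y in \<pi>. measure (kiter K n y) A = 0"
      by (subst (asm) integral_nonneg_eq_0_iff_AE) auto
    then show ?thesis by (simp add: kpow_eq_measure)
  qed
  then have "AE y in \<pi>. \<forall>n. kpow K n y A = 0" unfolding AE_all_countable by simp
  then have "AE y in \<pi>. False"
    using assms by (elim eventually_mono) (auto simp: accessible_def, metis less_irrefl)
  then show False by (simp only: prob_space.AE_False[OF prob_Pi])
qed

text \<open>Terms with a positive limit give a divergent series, but only for almost every start.
  From an arbitrary \<open>x\<close> one step dominates a multiple of Lebesgue measure on a ball,
  and almost every point there has a divergent series; this step accounts for the \<open>Suc\<close>
  in the sum.\<close>

lemma recurrent: "recurrent K"
  unfolding recurrent_def
proof (intro allI impI ballI)
  fix A x assume acc: "accessible K A" and "x \<in> A"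
  have A [measurable]: "A \<in> sets borel" using acc by (simp add: accessible_def)
  have pos: "measure \<pi> A > 0" using acc by (rule Pi_pos_of_accessible)
  have "AE y in lborel. (\<Sum>n. kpow K n y A) = \<infinity>"
    using AE_tv_dist_tendsto unfolding AE_Pi_iff
  proof (rule eventually_mono)
    fix y assume lim: "(\<lambda>n. tv_dist_kpow K n y \<pi>) \<longlonglongrightarrow> 0"
    have "\<bar>enn2real (kpow K n y A) - measure \<pi> A\<bar> \<le> tv_dist_kpow K n y \<pi>" for n
      unfolding tv_dist_kpow_def
    proof (intro cSUP_upper bdd_aboveI2[where M=1])
      fix B :: "'a set" assume B: "B \<in> sets borel"
      have "0 \<le> measure \<pi> B" "measure \<pi> B \<le> 1" "0 \<le> enn2real (kpow K n y B)" "enn2real (kpow K n y B) \<le> 1"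
        using prob_space.prob_le_1[OF prob_Pi] prob_space.prob_le_1[OF prob_kiter] B
        by (auto simp: kpow_eq_measure)
      then show "\<bar>enn2real (kpow K n y B) - measure \<pi> B\<bar> \<le> 1" by linarith
    qed (rule A)
    then have "(\<lambda>n. enn2real (kpow K n y A) - measure \<pi> A) \<longlonglongrightarrow> 0"
      by (intro Lim_null_comparison[OF _ lim] always_eventually) simp
    then have "(\<lambda>n. measure (kiter K n y) A) \<longlonglongrightarrow> measure \<pi> A"
      using A by (simp add: LIM_zero_iff kpow_eq_measure)
    then have "\<not> summable (\<lambda>n. measure (kiter K n y) A)"
      using pos summable_LIMSEQ_zero LIMSEQ_unique by fastforce
    then have "(\<Sum>n. ennreal (measure (kiter K n y) A)) = \<top>"
      using summable_suminf_not_top[of "\<lambda>n. measure (kiter K n y) A"] by (metis measure_nonneg)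
    then show "(\<Sum>n. kpow K n y A) = \<infinity>" by (simp only: kpow_eq_measure[OF A] infinity_ennreal_def)
  qed
  define r where "r = norm x + 1"
  have r: "r > 0" "x \<in> cball 0 r" by (auto simp: r_def add_nonneg_pos)
  obtain c where c: "c > 0" "\<And>x. x \<in> cball 0 r \<Longrightarrow> ball_lebesgue c r \<le> K x"
    using ball_minorization[OF r(1)] by blast
  have "AE y in ball_lebesgue c r. (\<Sum>n. kpow K n y A) = \<infinity>"
    unfolding AE_ball_lebesgue_iff[OF c(1)]
    using \<open>AE y in lborel. _\<close> by (rule eventually_mono) simp
  then have "(\<integral>\<^sup>+y. (\<Sum>n. kpow K n y A) \<partial>ball_lebesgue c r) = (\<integral>\<^sup>+y. \<infinity> \<partial>(ball_lebesgue c r :: 'a measure))"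
    by (rule nn_integral_cong_AE)
  also have "\<dots> = \<infinity>"
    using c(1) emeasure_lborel_cball_pos[OF r(1), of "0::'a"]
    by (simp add: emeasure_ball_lebesgue ennreal_top_mult)
  finally have "\<infinity> \<le> (\<integral>\<^sup>+y. (\<Sum>n. kpow K n y A) \<partial>K x)"
    using nn_integral_ball_lebesgue_le[OF c(2)[OF r(2)], of "\<lambda>y. (\<Sum>n. kpow K n y A)"] by simp
  also have "\<dots> = (\<Sum>n. kpow K (Suc n) x A)"
    using kpow_measurable[OF A] by (subst nn_integral_suminf) auto
  finally show "(\<Sum>n. kpow K (Suc n) x A) = \<infinity>" by (simp add: top_unique)
qed

end

section \<open>Preimages under Lipschitz maps\<close>

lemma emeasure_le_of_negligible_diff:
  assumes "A \<in> sets borel" "B \<in> sets borel" "negligible (A - B)"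
  shows "emeasure lborel A \<le> emeasure lborel (B :: 'a::euclidean_space set)"
proof -
  have "A - B \<in> null_sets lebesgue" using assms(3) by (simp add: negligible_iff_null_sets)
  then have "emeasure lborel (A - B) = 0"
    using assms(1,2) by (simp add: null_sets_def)
  moreover have "emeasure lborel A \<le> emeasure lborel (B \<union> (A - B))"
    using assms by (intro emeasure_mono) auto
  moreover have "\<dots> \<le> emeasure lborel B + emeasure lborel (A - B)"
    using assms by (intro emeasure_subadditive) auto
  ultimately show ?thesis by simp
qed

text \<open>A Lipschitz map need not be injective or differentiable, but the preimage of a small ball
  contains a comparable ball around any preimage of its centre; Vitali's covering theorem turns
  this into a comparison of measures.\<close>
lemma lipschitz_preimage_measure_ge:
  fixes f :: "'a::euclidean_space \<Rightarrow> 'a"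
  assumes L: "L > 0" and lip: "\<And>x y. norm (f x - f y) \<le> L * norm (x - y)"
    and cover: "\<And>y. y \<in> A \<Longrightarrow> \<exists>x. f x = y \<and> ball x 1 \<subseteq> S"
    and S [measurable]: "S \<in> sets borel" and fin: "emeasure lborel S < \<infinity>" and A: "A \<in> sets borel"
  shows "ennreal (inverse L ^ DIM('a)) * emeasure lborel A \<le> emeasure lborel (S \<inter> f -` A)"
proof -
  have "L-lipschitz_on UNIV f"
    using L lip by (intro lipschitz_onI) (auto simp: dist_norm)
  then have "continuous_on UNIV f" by (rule lipschitz_on_continuous_on)
  then have f [measurable]: "f \<in> borel_measurable borel" by (rule borel_measurable_continuous_onI)
  \<comment> \<open>Restricting to \<open>S\<close> before pushing forward makes the measure finite,
    which outer regularity requires below.\<close>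
  define \<mu> where "\<mu> = distr (density lborel (indicator S)) borel f"
  have sets_mu [simp]: "sets \<mu> = sets borel" and space_mu [simp]: "space \<mu> = UNIV" by (simp_all add: \<mu>_def)
  have mu: "emeasure \<mu> X = emeasure lborel (S \<inter> f -` X)" if [measurable]: "X \<in> sets borel" for X
  proof -
    have "emeasure \<mu> X = emeasure (density lborel (indicator S)) (f -` X)"
      unfolding \<mu>_def using that by (subst emeasure_distr) auto
    also have "\<dots> = (\<integral>\<^sup>+x. indicator S x * indicator (f -` X) x \<partial>lborel)"
      using measurable_sets[OF f that] by (subst emeasure_density) auto
    also have "\<dots> = emeasure lborel (S \<inter> f -` X)"
      unfolding indicator_inter_arith[symmetric]
      using measurable_sets[OF f that] S by (intro nn_integral_indicator) simp
    finally show ?thesis .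
  qed
  define k where "k = ennreal (inverse L ^ DIM('a))"
  \<comment> \<open>The ball of radius \<open>\<rho> / L\<close> about a preimage is mapped into
    \<open>ball y \<rho>\<close>, and \<open>\<rho> \<le> L\<close> keeps it inside
    \<open>S\<close>. The constant \<open>k\<close> is the ratio of the two volumes.\<close>
  have ball: "k * emeasure lborel (ball y \<rho>) \<le> emeasure \<mu> (ball y \<rho>)"
    if y: "y \<in> A" and \<rho>: "0 < \<rho>" "\<rho> \<le> L" for y \<rho>
  proof -
    obtain x where x: "f x = y" "ball x 1 \<subseteq> S" using cover[OF y] by blast
    have "ball x (\<rho> / L) \<subseteq> S \<inter> f -` ball y \<rho>"
    proof
      fix z assume z: "z \<in> ball x (\<rho> / L)"
      moreover have "\<rho> / L \<le> 1" using \<rho> L by simp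
      ultimately have "z \<in> S" using x(2) by (auto simp: subset_iff)
      have "norm (f x - f z) \<le> L * norm (x - z)" by (rule lip)
      also have "\<dots> < \<rho>" using z L by (simp add: dist_norm field_simps)
      finally show "z \<in> S \<inter> f -` ball y \<rho>" using x(1) \<open>z \<in> S\<close> by (simp add: dist_norm)
    qed
    then have "emeasure lborel (ball x (\<rho> / L)) \<le> emeasure \<mu> (ball y \<rho>)"
      using measurable_sets[OF f, of "ball y \<rho>"] S by (simp add: mu emeasure_mono)
    also have "emeasure lborel (ball x (\<rho> / L)) = k * emeasure lborel (ball y \<rho>)"
      using \<rho> L by (simp add: emeasure_ball k_def power_divide inverse_eq_divide ennreal_mult'[symmetric] field_simps)
    finally show ?thesis .
  qed
  \<comment> \<open>Disjoint balls inside \<open>W\<close> exhaust \<open>A\<close> up to a null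
    set, so the bound for single balls can be summed.\<close>
  have open_le: "k * emeasure lborel A \<le> emeasure \<mu> W" if W: "open W" "A \<subseteq> W" for W
  proof -
    let ?K = "{(y, \<rho>). y \<in> A \<and> 0 < \<rho> \<and> \<rho> \<le> L \<and> ball y \<rho> \<subseteq> W}"
    have small_balls: "\<exists>i. i \<in> ?K \<and> x \<in> ball (fst i) (snd i) \<and> snd i < d" if "x \<in> A" "0 < d" for x d
    proof -
      obtain e where e: "e > 0" "ball x e \<subseteq> W" using W \<open>x \<in> A\<close> by (meson openE subsetD)
      define \<rho> where "\<rho> = min (min e (d / 2)) L"
      have "0 < \<rho>" "\<rho> \<le> L" "\<rho> < d" "\<rho> \<le> e" using e L \<open>0 < d\<close> by (auto simp: \<rho>_def)
      moreover from this have "ball x \<rho> \<subseteq> W" using e by (meson order_trans subset_ball)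
      ultimately show ?thesis using \<open>x \<in> A\<close> by (intro exI[of _ "(x, \<rho>)"]) auto
    qed
    obtain C where C: "countable C" "C \<subseteq> ?K"
      "pairwise (\<lambda>i j. disjnt (ball (fst i) (snd i)) (ball (fst j) (snd j))) C"
      "negligible (A - (\<Union>i\<in>C. ball (fst i) (snd i)))"
      by (rule Vitali_covering_theorem_balls[of A ?K fst snd, OF small_balls])
    let ?V = "\<Union>i\<in>C. ball (fst i) (snd i)"
    have V: "open ?V" by auto
    have disj: "disjoint_family_on (\<lambda>i. ball (fst i) (snd i)) C"
      using C(3) by (auto simp: disjoint_family_on_def pairwise_def disjnt_def)
    have "k * emeasure lborel A \<le> k * emeasure lborel ?V"
      using A V C(4) by (intro mult_left_mono emeasure_le_of_negligible_diff) auto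
    also have "emeasure lborel ?V = (\<integral>\<^sup>+i. emeasure lborel (ball (fst i) (snd i)) \<partial>count_space C)"
      using C(1) disj by (intro emeasure_UN_countable) auto
    also have "k * \<dots> = (\<integral>\<^sup>+i. k * emeasure lborel (ball (fst i) (snd i)) \<partial>count_space C)"
      by (simp add: nn_integral_cmult)
    also have "\<dots> \<le> (\<integral>\<^sup>+i. emeasure \<mu> (ball (fst i) (snd i)) \<partial>count_space C)"
      using C(2) by (intro nn_integral_mono ball) auto
    also have "\<dots> = emeasure \<mu> ?V"
      using C(1) disj by (intro emeasure_UN_countable[symmetric]) auto
    also have "\<dots> \<le> emeasure \<mu> W"
    proof (rule emeasure_mono)
      have "ball (fst i) (snd i) \<subseteq> W" if "i \<in> C" for i using subsetD[OF C(2) that] by auto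
      then show "?V \<subseteq> W" by blast
    qed (use W(1) in simp)
    finally show ?thesis .
  qed
  \<comment> \<open>Outer regularity of \<open>\<mu>\<close> lets \<open>W\<close> shrink to
    \<open>A\<close>.\<close>
  have "emeasure \<mu> (space \<mu>) \<le> emeasure lborel S"
    by (simp add: mu)
  then have "emeasure \<mu> (space \<mu>) \<noteq> \<infinity>" using fin by (auto simp: top_unique)
  then have "emeasure \<mu> A = (INF W \<in> {W. A \<subseteq> W \<and> open W}. emeasure \<mu> W)"
    using A by (intro outer_regular) auto
  also have "k * emeasure lborel A \<le> \<dots>" using open_le by (intro INF_greatest) auto
  finally show ?thesis using A by (simp add: mu k_def)
qed

section \<open>Invariance of the target\<close>

definition flip_momentum :: "'a::euclidean_space \<times> 'a \<Rightarrow> 'a \<times> 'a" where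
  "flip_momentum z = (fst z, - snd z)"

lemma psi1_eq: "psi1 gradU h z = (fst z, snd z - (h / 2) *\<^sub>R gradU (fst z))"
  by (simp add: psi1_def case_prod_beta)

lemma psi2_eq: "psi2 h z = (fst z + h *\<^sub>R snd z, snd z)"
  by (simp add: psi2_def case_prod_beta)

text \<open>Conjugation by the momentum flip inverts each elementary map, and their composition is a
  palindrome, so the flip reverses the whole step.\<close>

lemma leapfrog_flip:
  fixes gradU :: "'a::euclidean_space \<Rightarrow> 'a"
  shows "leapfrog gradU h (flip_momentum (leapfrog gradU h z)) = flip_momentum z"
proof -
  have "psi1 gradU h (flip_momentum (psi1 gradU h w)) = flip_momentum w" for w
    by (simp add: psi1_eq flip_momentum_def)
  moreover have "psi2 h (flip_momentum (psi2 h w)) = flip_momentum w" for w :: "'a \<times> 'a"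
    by (simp add: psi2_eq flip_momentum_def)
  ultimately show ?thesis by (simp add: leapfrog_def)
qed

lemma leapfrogT_flip: "leapfrogT gradU h T (flip_momentum (leapfrogT gradU h T z)) = flip_momentum z"
proof (induction T arbitrary: z)
  case (Suc T)
  \<comment> \<open>The outer power gives up its last step and the inner power its first, so that
    the induction hypothesis fits between them.\<close>
  have "leapfrogT gradU h (Suc T) (flip_momentum (leapfrogT gradU h (Suc T) z))
      = leapfrog gradU h (leapfrogT gradU h T (flip_momentum (leapfrogT gradU h T (leapfrog gradU h z))))"
    unfolding leapfrogT_def by (simp only: funpow_Suc_right comp_apply) (simp only: funpow_swap1[symmetric])
  also have "\<dots> = flip_momentum z" by (simp add: Suc leapfrog_flip)
  finally show ?case .
qed (simp add: leapfrogT_def)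

lemma fst_flip [simp]: "fst (flip_momentum z) = fst z"
  by (simp add: flip_momentum_def)

lemma leapfrogT_Suc: "leapfrogT gradU h (Suc n) z = leapfrog gradU h (leapfrogT gradU h n z)"
  by (simp add: leapfrogT_def)

lemma leapfrogT_0 [simp]: "leapfrogT gradU h 0 z = z"
  by (simp add: leapfrogT_def)

lemma continuous_leapfrogT:
  assumes "continuous_on UNIV gradU"
  shows "continuous_on UNIV (leapfrogT gradU h n)"
proof (induction n)
  case (Suc n)
  have c: "continuous_on X (\<lambda>x. gradU (g x))" if "continuous_on X g" for X and g :: "'a \<times> 'a \<Rightarrow> 'a"
    using continuous_on_compose2[OF assms that] by simp
  have "continuous_on UNIV (leapfrog gradU h)"
    unfolding leapfrog_def comp_def psi1_eq psi2_eq by (intro continuous_intros c)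
  from continuous_on_compose2[OF this Suc] show ?case by (simp add: leapfrogT_Suc[abs_def])
qed (simp add: leapfrogT_def)

section \<open>Volume preservation of the leapfrog flow\<close>

definition volume_preserving :: "('a::euclidean_space \<Rightarrow> 'a) \<Rightarrow> bool" where
  "volume_preserving F \<longleftrightarrow> F \<in> borel_measurable borel \<and>
     (\<forall>f\<in>borel_measurable borel. (\<integral>\<^sup>+z. f (F z) \<partial>lborel) = (\<integral>\<^sup>+z. f z \<partial>lborel))"

lemma volume_preserving_comp:
  "volume_preserving F \<Longrightarrow> volume_preserving G \<Longrightarrow> volume_preserving (F \<circ> G)"
  unfolding volume_preserving_def
proof (intro conjI ballI)
  assume F: "F \<in> borel_measurable borel \<and> (\<forall>f\<in>borel_measurable borel. (\<integral>\<^sup>+z. f (F z) \<partial>lborel) = (\<integral>\<^sup>+z. f z \<partial>lborel))"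
    and G: "G \<in> borel_measurable borel \<and> (\<forall>f\<in>borel_measurable borel. (\<integral>\<^sup>+z. f (G z) \<partial>lborel) = (\<integral>\<^sup>+z. f z \<partial>lborel))"
  show "F \<circ> G \<in> borel_measurable borel" using F G by (auto intro: measurable_comp)
  fix f :: "'a \<Rightarrow> ennreal" assume f: "f \<in> borel_measurable borel"
  then have "(\<lambda>z. f (F z)) \<in> borel_measurable borel" using F by (auto intro: measurable_compose)
  from G[THEN conjunct2, rule_format, OF this] F[THEN conjunct2, rule_format, OF f]
  show "(\<integral>\<^sup>+z. f ((F \<circ> G) z) \<partial>lborel) = (\<integral>\<^sup>+z. f z \<partial>lborel)" by simp
qed

lemma nn_integral_lborel_translate:
  fixes c :: "'a::euclidean_space"
  assumes [measurable]: "f \<in> borel_measurable borel"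
  shows "(\<integral>\<^sup>+x. f (c + x) \<partial>lborel) = (\<integral>\<^sup>+x. f x \<partial>lborel)"
proof -
  have "(\<integral>\<^sup>+x. f x \<partial>lborel) = (\<integral>\<^sup>+x. f x \<partial>distr lborel borel ((+) c))"
    by (simp add: lborel_distr_plus)
  also have "\<dots> = (\<integral>\<^sup>+x. f (c + x) \<partial>lborel)" by (subst nn_integral_distr) auto
  finally show ?thesis ..
qed

lemma nn_integral_lborel_uminus:
  fixes f :: "'a::euclidean_space \<Rightarrow> ennreal"
  assumes [measurable]: "f \<in> borel_measurable borel"
  shows "(\<integral>\<^sup>+x. f (- x) \<partial>lborel) = (\<integral>\<^sup>+x. f x \<partial>lborel)"
proof -
  have "(lborel :: 'a measure) = distr lborel borel (\<lambda>x. - x)"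
    using lborel_affine[of "-1" "0::'a"] by (simp add: density_1)
  then have "(\<integral>\<^sup>+x. f x \<partial>lborel) = (\<integral>\<^sup>+x. f x \<partial>distr lborel borel (\<lambda>x. - x))" by simp
  also have "\<dots> = (\<integral>\<^sup>+x. f (- x) \<partial>lborel)" by (subst nn_integral_distr) auto
  finally show ?thesis ..
qed

lemma nn_integral_lborel_pair:
  fixes f :: "'a::euclidean_space \<times> 'b::euclidean_space \<Rightarrow> ennreal"
  assumes f: "f \<in> borel_measurable borel"
  shows "(\<integral>\<^sup>+z. f z \<partial>lborel) = (\<integral>\<^sup>+x. \<integral>\<^sup>+y. f (x, y) \<partial>lborel \<partial>lborel)"
    and "(\<integral>\<^sup>+z. f z \<partial>lborel) = (\<integral>\<^sup>+y. \<integral>\<^sup>+x. f (x, y) \<partial>lborel \<partial>lborel)"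
proof -
  interpret pair_sigma_finite "lborel :: 'a measure" "lborel :: 'b measure" ..
  have f': "f \<in> borel_measurable (lborel \<Otimes>\<^sub>M lborel)"
    using f by (simp add: lborel_prod)
  show "(\<integral>\<^sup>+z. f z \<partial>lborel) = (\<integral>\<^sup>+x. \<integral>\<^sup>+y. f (x, y) \<partial>lborel \<partial>lborel)"
    using lborel.nn_integral_fst[OF f'] by (simp add: lborel_prod)
  show "(\<integral>\<^sup>+z. f z \<partial>lborel) = (\<integral>\<^sup>+y. \<integral>\<^sup>+x. f (x, y) \<partial>lborel \<partial>lborel)"
    using lborel.nn_integral_fst[OF f'] lborel_pair.Fubini[OF f'] by (simp add: lborel_prod)
qed

lemma borel_measurable_Pair2:
  fixes f :: "'a::euclidean_space \<times> 'b::euclidean_space \<Rightarrow> _"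
  assumes "f \<in> borel_measurable borel"
  shows "(\<lambda>y. f (x, y)) \<in> borel_measurable borel" "(\<lambda>x. f (x, y)) \<in> borel_measurable borel"
  using assms unfolding borel_prod[symmetric] by measurable

text \<open>A shear: for a fixed position it translates the momentum. Tonelli and translation
  invariance replace a Jacobian, for which \<open>gradU\<close> would have to be
  differentiable.\<close>

lemma volume_preserving_psi1:
  assumes [measurable]: "gradU \<in> borel_measurable borel"
  shows "volume_preserving (psi1 gradU h)"
  unfolding volume_preserving_def
proof (intro conjI ballI)
  show meas [measurable]: "psi1 gradU h \<in> borel_measurable borel"
    unfolding psi1_eq[abs_def] borel_prod[symmetric] by measurable
  fix f :: "'a \<times> 'a \<Rightarrow> ennreal" assume f [measurable]: "f \<in> borel_measurable borel"
  have "(\<integral>\<^sup>+z. f (psi1 gradU h z) \<partial>lborel)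
      = (\<integral>\<^sup>+q. \<integral>\<^sup>+p. f (q, - (h / 2) *\<^sub>R gradU q + p) \<partial>lborel \<partial>lborel)"
    by (subst nn_integral_lborel_pair(1)) (measurable, simp add: psi1_eq)
  also have "\<dots> = (\<integral>\<^sup>+q. \<integral>\<^sup>+p. f (q, p) \<partial>lborel \<partial>lborel)"
    by (intro nn_integral_cong nn_integral_lborel_translate borel_measurable_Pair2 f)
  also have "\<dots> = (\<integral>\<^sup>+z. f z \<partial>lborel)" by (rule nn_integral_lborel_pair(1)[OF f, symmetric])
  finally show "(\<integral>\<^sup>+z. f (psi1 gradU h z) \<partial>lborel) = (\<integral>\<^sup>+z. f z \<partial>lborel)" .
qed

lemma volume_preserving_psi2: "volume_preserving (psi2 h)"
  unfolding volume_preserving_def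
proof (intro conjI ballI)
  show meas [measurable]: "psi2 h \<in> borel_measurable borel"
    unfolding psi2_eq[abs_def] borel_prod[symmetric] by measurable
  fix f :: "'a \<times> 'a \<Rightarrow> ennreal" assume f [measurable]: "f \<in> borel_measurable borel"
  have "(\<integral>\<^sup>+z. f (psi2 h z) \<partial>lborel)
      = (\<integral>\<^sup>+p. \<integral>\<^sup>+q. f (h *\<^sub>R p + q, p) \<partial>lborel \<partial>lborel)"
    by (subst nn_integral_lborel_pair(2)) (measurable, simp add: psi2_eq add.commute)
  also have "\<dots> = (\<integral>\<^sup>+p. \<integral>\<^sup>+q. f (q, p) \<partial>lborel \<partial>lborel)"
    by (intro nn_integral_cong nn_integral_lborel_translate[of "\<lambda>q. f (q, _)"] borel_measurable_Pair2 f)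
  also have "\<dots> = (\<integral>\<^sup>+z. f z \<partial>lborel)" by (rule nn_integral_lborel_pair(2)[OF f, symmetric])
  finally show "(\<integral>\<^sup>+z. f (psi2 h z) \<partial>lborel) = (\<integral>\<^sup>+z. f z \<partial>lborel)" .
qed

lemma volume_preserving_flip: "volume_preserving flip_momentum"
  unfolding volume_preserving_def
proof (intro conjI ballI)
  show meas [measurable]: "flip_momentum \<in> borel_measurable borel"
    unfolding flip_momentum_def[abs_def] borel_prod[symmetric] by measurable
  fix f :: "'a \<times> 'a \<Rightarrow> ennreal" assume f [measurable]: "f \<in> borel_measurable borel"
  have "(\<integral>\<^sup>+z. f (flip_momentum z) \<partial>lborel) = (\<integral>\<^sup>+q. \<integral>\<^sup>+p. f (q, - p) \<partial>lborel \<partial>lborel)"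
    by (subst nn_integral_lborel_pair(1)) (measurable, simp add: flip_momentum_def)
  also have "\<dots> = (\<integral>\<^sup>+q. \<integral>\<^sup>+p. f (q, p) \<partial>lborel \<partial>lborel)"
    by (intro nn_integral_cong nn_integral_lborel_uminus[of "\<lambda>p. f (_, p)"] borel_measurable_Pair2 f)
  also have "\<dots> = (\<integral>\<^sup>+z. f z \<partial>lborel)" by (rule nn_integral_lborel_pair(1)[OF f, symmetric])
  finally show "(\<integral>\<^sup>+z. f (flip_momentum z) \<partial>lborel) = (\<integral>\<^sup>+z. f z \<partial>lborel)" .
qed

lemma volume_preserving_leapfrogT:
  assumes "gradU \<in> borel_measurable borel"
  shows "volume_preserving (leapfrogT gradU h n)"
proof (induction n)
  case 0
  have "leapfrogT gradU h 0 = (\<lambda>z. z)" by (simp add: leapfrogT_def fun_eq_iff)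
  then show ?case by (simp add: volume_preserving_def)
next
  case (Suc n)
  have "leapfrogT gradU h (Suc n) = leapfrog gradU h \<circ> leapfrogT gradU h n" by (simp add: leapfrogT_def)
  moreover have "volume_preserving (leapfrog gradU h)"
    unfolding leapfrog_def
    by (intro volume_preserving_comp volume_preserving_psi1 volume_preserving_psi2 assms)
  ultimately show ?case using Suc volume_preserving_comp by metis
qed

section \<open>Normalization of the Gaussian momentum\<close>

lemma gauss_pos: "gauss p > 0"
  by (simp add: gauss_def)

lemma continuous_gauss: "continuous_on UNIV (gauss :: 'a::euclidean_space \<Rightarrow> real)"
  unfolding gauss_def[abs_def] by (intro continuous_intros) auto

lemma measurable_gauss [measurable]: "(gauss :: 'a::euclidean_space \<Rightarrow> real) \<in> borel_measurable borel"
  by (rule borel_measurable_continuous_onI[OF continuous_gauss])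

lemma gauss_prod: "gauss p = (\<Prod>b\<in>Basis. std_normal_density (p \<bullet> b))" for p :: "'a::euclidean_space"
proof -
  have "(\<Prod>b\<in>Basis. std_normal_density (p \<bullet> b))
      = (1 / sqrt (2 * pi)) ^ DIM('a) * exp (\<Sum>b\<in>Basis. - (p \<bullet> b)\<^sup>2 / 2)"
    by (simp only: std_normal_density_def prod.distrib prod_constant exp_sum[OF finite_Basis])
  also have "(\<Sum>b\<in>Basis. - (p \<bullet> b)\<^sup>2 / 2) = - (norm p)\<^sup>2 / 2"
  proof -
    have "(\<Sum>b\<in>Basis. - (p \<bullet> b)\<^sup>2 / 2) = - (\<Sum>b\<in>Basis. (p \<bullet> b) * (p \<bullet> b)) / 2"
      by (simp add: sum_negf sum_divide_distrib power2_eq_square)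
    then show ?thesis by (simp add: power2_norm_eq_inner euclidean_inner[of p p])
  qed
  also have "(1 / sqrt (2 * pi)) ^ DIM('a) = (2 * pi) powr (- real DIM('a) / 2)"
  proof -
    have "1 / sqrt (2 * pi) = (2 * pi) powr (- 1 / 2)"
      by (simp add: powr_minus powr_half_sqrt inverse_eq_divide)
    then have "(1 / sqrt (2 * pi)) ^ DIM('a) = ((2 * pi) powr (- 1 / 2)) powr real DIM('a)"
      by (simp add: powr_realpow)
    then show ?thesis by (simp add: powr_powr)
  qed
  finally show ?thesis by (simp add: gauss_def)
qed

lemma nn_integral_gauss: "(\<integral>\<^sup>+p. ennreal (gauss p) \<partial>(lborel :: 'a::euclidean_space measure)) = 1"
proof -
  have "(\<integral>\<^sup>+p. ennreal (gauss p) \<partial>(lborel :: 'a measure))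
      = (\<integral>\<^sup>+p. (\<Prod>b\<in>Basis. ennreal (std_normal_density (p \<bullet> b))) \<partial>(lborel :: 'a measure))"
    by (simp add: gauss_prod prod_ennreal)
  also have "\<dots> = (\<Prod>b\<in>(Basis :: 'a set). (\<integral>\<^sup>+x. ennreal (std_normal_density x) \<partial>lborel))"
    by (subst nn_integral_lborel_prod) auto
  also have "(\<integral>\<^sup>+x. ennreal (std_normal_density x) \<partial>lborel) = 1"
    using prob_space.emeasure_space_1[OF prob_space_normal_density[of 1 0]]
    by (simp add: emeasure_density)
  finally show ?thesis by simp
qed

lemma integrable_gauss: "integrable lborel (gauss :: 'a::euclidean_space \<Rightarrow> real)"
  by (rule integrableI_nonneg) (auto simp: nn_integral_gauss gauss_pos less_imp_le)

section \<open>The kernel as a Markov kernel\<close>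

locale hmc_chain =
  fixes U :: "'a::euclidean_space \<Rightarrow> real" and gradU :: "'a \<Rightarrow> 'a" and h :: real and T :: nat
  assumes continuous_U: "continuous_on UNIV U" and continuous_gradU: "continuous_on UNIV gradU"
    and integrable_exp: "integrable lborel (\<lambda>q. exp (- U q))"
begin

definition flow :: "'a \<times> 'a \<Rightarrow> 'a \<times> 'a" where "flow = leapfrogT gradU h T"

definition accept :: "'a \<times> 'a \<Rightarrow> real" where "accept z = alphaH U z (flow z)"

text \<open>The accepted and the rejected part of the kernel as one nonnegative integrand on phase
  space, so that additivity, measurability in the start and invariance all become statements about
  Tonelli integrals.\<close>

definition moved :: "'a set \<Rightarrow> 'a \<times> 'a \<Rightarrow> ennreal" where
  "moved A z = ennreal (accept z * gauss (snd z)) * indicator A (fst (flow z))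
     + ennreal ((1 - accept z) * gauss (snd z)) * indicator A (fst z)"

lemma measurable_U [measurable]: "U \<in> borel_measurable borel"
  by (rule borel_measurable_continuous_onI[OF continuous_U])

lemma measurable_gradU [measurable]: "gradU \<in> borel_measurable borel"
  by (rule borel_measurable_continuous_onI[OF continuous_gradU])

lemma continuous_flow: "continuous_on UNIV flow"
  unfolding flow_def by (rule continuous_leapfrogT[OF continuous_gradU])

lemma measurable_flow [measurable]: "flow \<in> borel_measurable borel"
  by (rule borel_measurable_continuous_onI[OF continuous_flow])

lemma continuous_accept: "continuous_on UNIV accept"
proof -
  have [continuous_intros]: "continuous_on UNIV (\<lambda>z. U (fst z))"
    by (rule continuous_on_compose2[OF continuous_U]) (auto intro: continuous_intros)
  have [continuous_intros]: "continuous_on UNIV (\<lambda>z. U (fst (flow z)))"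
    by (rule continuous_on_compose2[OF continuous_U]) (auto intro!: continuous_intros continuous_flow)
  show ?thesis
    unfolding accept_def alphaH_def hamiltonian_def case_prod_beta
    by (intro continuous_intros continuous_flow) auto
qed

lemma measurable_accept [measurable]: "accept \<in> borel_measurable borel"
  by (rule borel_measurable_continuous_onI[OF continuous_accept])

lemma accept_pos: "0 < accept z" and accept_le_1: "accept z \<le> 1"
  by (auto simp: accept_def alphaH_def)

lemma measurable_fst_borel [measurable]: "fst \<in> borel_measurable (borel :: ('a \<times> 'a) measure)"
  and measurable_snd_borel [measurable]: "snd \<in> borel_measurable (borel :: ('a \<times> 'a) measure)"
  unfolding borel_prod[symmetric] by measurable

lemma measurable_exp_U_fst: "(\<lambda>z. exp (- U (fst z))) \<in> borel_measurable (borel :: ('a \<times> 'a) measure)"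
proof -
  have "(\<lambda>q. exp (- U q)) \<in> borel_measurable borel" by measurable
  from measurable_compose[OF measurable_fst_borel this] show ?thesis .
qed

lemma measurable_moved [measurable (raw)]:
  assumes [measurable]: "A \<in> sets borel"
  shows "moved A \<in> borel_measurable borel"
  unfolding moved_def[abs_def] by measurable

lemma hmc_kernel_eq:
  assumes A [measurable]: "A \<in> sets borel"
  shows "ennreal (hmc_kernel U gradU h T q A) = (\<integral>\<^sup>+p. moved A (q, p) \<partial>lborel)"
proof -
  have [measurable]: "(\<lambda>p. accept (q, p)) \<in> borel_measurable borel"
     "(\<lambda>p. fst (flow (q, p))) \<in> borel_measurable borel"
    by (auto intro!: borel_measurable_Pair2 measurable_compose[OF measurable_flow])
  let ?f = "\<lambda>p. indicator A (fst (flow (q, p))) * accept (q, p) * gauss p"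
  let ?g = "\<lambda>p. (1 - accept (q, p)) * gauss p"
  have acc: "0 \<le> accept z" "accept z \<le> 1" for z using accept_pos[of z] accept_le_1[of z] by auto
  have ag: "0 \<le> accept z * gauss p" "accept z * gauss p \<le> gauss p"
    "0 \<le> (1 - accept z) * gauss p" "(1 - accept z) * gauss p \<le> gauss p" for z and p :: 'a
    using acc[of z] gauss_pos[of p] by (auto simp: algebra_simps)
  have gabs: "\<bar>gauss p\<bar> = gauss p" for p :: 'a using gauss_pos[of p] by simp
  have g0: "0 \<le> gauss p" for p :: 'a using gauss_pos[of p] by simp
  have f: "integrable lborel ?f" "0 \<le> (\<integral>p. ?f p \<partial>lborel)"
   and g: "integrable lborel ?g" "0 \<le> (\<integral>p. ?g p \<partial>lborel)"
    using ag g0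
    by (auto intro!: Bochner_Integration.integrable_bound[OF integrable_gauss] Bochner_Integration.integral_nonneg
        simp: indicator_def gabs g0 simp del: abs_mult)
  have "ennreal (hmc_kernel U gradU h T q A)
      = ennreal (\<integral>p. ?f p \<partial>lborel) + ennreal (\<integral>p. ?g p \<partial>lborel) * indicator A q"
    using f(2) g(2) unfolding hmc_kernel_def accept_def flow_def
    by (auto simp: indicator_def)
  also have "ennreal (\<integral>p. ?f p \<partial>lborel) = (\<integral>\<^sup>+p. ?f p \<partial>lborel)"
    using f(1) ag(1) g0 by (intro nn_integral_eq_integral[symmetric]) (auto simp: indicator_def)
  also have "ennreal (\<integral>p. ?g p \<partial>lborel) = (\<integral>\<^sup>+p. ?g p \<partial>lborel)"
    using g(1) ag(3) by (intro nn_integral_eq_integral[symmetric]) auto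
  also have "(\<integral>\<^sup>+p. ?f p \<partial>lborel) + (\<integral>\<^sup>+p. ?g p \<partial>lborel) * indicator A q
      = (\<integral>\<^sup>+p. ennreal (?f p) + ennreal (?g p) * indicator A q \<partial>lborel)"
    by (simp add: nn_integral_add nn_integral_multc)
  also have "\<dots> = (\<integral>\<^sup>+p. moved A (q, p) \<partial>lborel)"
    by (intro nn_integral_cong) (auto simp: moved_def indicator_def)
  finally show ?thesis .
qed

lemma sets_hmc [simp, measurable_cong]: "sets (hmc U gradU h T q) = sets borel"
  and space_hmc [simp]: "space (hmc U gradU h T q) = UNIV"
  using sets.sigma_sets_eq[of "borel :: 'a measure"] by (simp_all add: hmc_def)

lemma moved_UN:
  assumes "disjoint_family B"
  shows "(\<Sum>i. moved (B i) z) = moved (\<Union>i. B i) z"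
  unfolding moved_def
  by (simp add: suminf_add[symmetric] ennreal_suminf_cmult suminf_indicator[OF assms] summableI)

lemma measurable_moved_Pair:
  assumes "A \<in> sets borel"
  shows "(\<lambda>p. moved A (q, p)) \<in> borel_measurable borel"
  by (intro borel_measurable_Pair2 measurable_moved assms)

text \<open>\<open>measure_of\<close> yields the given set function only if it is positive and
  countably additive, and the zero measure otherwise; this is where that condition is
  verified.\<close>

lemma emeasure_hmc:
  assumes "A \<in> sets borel"
  shows "emeasure (hmc U gradU h T q) A = (\<integral>\<^sup>+p. moved A (q, p) \<partial>lborel)"
proof -
  have "emeasure (hmc U gradU h T q) A = ennreal (hmc_kernel U gradU h T q A)"
  proof (rule emeasure_measure_of[OF hmc_def])
    show "positive (sets (hmc U gradU h T q)) (\<lambda>A. ennreal (hmc_kernel U gradU h T q A))"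
      by (simp add: positive_def hmc_kernel_def)
    show "countably_additive (sets (hmc U gradU h T q)) (\<lambda>A. ennreal (hmc_kernel U gradU h T q A))"
    proof (rule countably_additiveI)
      fix B :: "nat \<Rightarrow> 'a set"
      assume "range B \<subseteq> sets (hmc U gradU h T q)" and disj: "disjoint_family B"
      then have B: "\<And>i. B i \<in> sets borel" by auto
      then have UB: "(\<Union>i. B i) \<in> sets borel" by auto
      have "(\<Sum>i. ennreal (hmc_kernel U gradU h T q (B i))) = (\<Sum>i. \<integral>\<^sup>+p. moved (B i) (q, p) \<partial>lborel)"
        by (simp only: hmc_kernel_eq[OF B])
      also have "\<dots> = (\<integral>\<^sup>+p. (\<Sum>i. moved (B i) (q, p)) \<partial>lborel)"
        using B by (intro nn_integral_suminf[symmetric]) (simp add: measurable_moved_Pair)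
      also have "\<dots> = ennreal (hmc_kernel U gradU h T q (\<Union>i. B i))"
        by (simp only: moved_UN[OF disj] hmc_kernel_eq[OF UB])
      finally show "(\<Sum>i. ennreal (hmc_kernel U gradU h T q (B i))) = ennreal (hmc_kernel U gradU h T q (\<Union>i. B i))" .
    qed
  qed (use assms in auto)
  then show ?thesis by (simp add: hmc_kernel_eq assms)
qed

lemma moved_UNIV: "moved UNIV z = ennreal (gauss (snd z))"
proof -
  have "moved UNIV z = ennreal (accept z * gauss (snd z) + (1 - accept z) * gauss (snd z))"
    using accept_pos[of z] accept_le_1[of z] gauss_pos[of "snd z"]
    by (simp add: moved_def ennreal_plus[symmetric] del: ennreal_plus)
  also have "accept z * gauss (snd z) + (1 - accept z) * gauss (snd z) = gauss (snd z)"
    by (simp add: algebra_simps)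
  finally show ?thesis .
qed

lemma prob_hmc: "prob_space (hmc U gradU h T q)"
  by (rule prob_spaceI) (simp add: emeasure_hmc moved_UNIV nn_integral_gauss)

lemma measurable_hmc: "hmc U gradU h T \<in> borel \<rightarrow>\<^sub>M prob_algebra borel"
proof (intro measurable_prob_algebraI prob_hmc measurable_subprob_algebra)
  fix A :: "'a set" assume A [measurable]: "A \<in> sets borel"
  have "(\<lambda>(q, p). moved A (q, p)) \<in> borel_measurable (borel \<Otimes>\<^sub>M lborel)"
  proof -
    have "sets (borel \<Otimes>\<^sub>M lborel) = sets (borel :: ('a \<times> 'a) measure)"
      unfolding borel_prod[symmetric] by (intro sets_pair_measure_cong) auto
    then show ?thesis unfolding case_prod_eta by (subst measurable_cong_sets[OF _ refl]) (auto intro: measurable_moved)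
  qed
  then have "(\<lambda>q. \<integral>\<^sup>+p. moved A (q, p) \<partial>lborel) \<in> borel_measurable borel"
    by (rule lborel.borel_measurable_nn_integral)
  then show "(\<lambda>q. emeasure (hmc U gradU h T q) A) \<in> borel_measurable borel"
    by (simp add: emeasure_hmc[OF A])
qed (auto intro: prob_space_imp_subprob_space prob_hmc)

section \<open>Detailed balance and invariance\<close>

definition \<rho> :: "'a \<times> 'a \<Rightarrow> real" where "\<rho> z = exp (- U (fst z)) * gauss (snd z)"

lemma measurable_rho [measurable]: "\<rho> \<in> borel_measurable borel"
  unfolding \<rho>_def[abs_def]
  by (intro borel_measurable_times measurable_exp_U_fst
      measurable_compose[OF measurable_snd_borel measurable_gauss])

text \<open>Up to a constant \<open>\<rho>\<close> is the exponential of minus the Hamiltonian, so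
  the Metropolis ratio is a quotient of values of \<open>\<rho>\<close>. The resulting minimum is
  symmetric in the two states, which is detailed balance.\<close>

lemma rho_accept: "\<rho> z * accept z = min (\<rho> z) (\<rho> (flow z))"
proof -
  define \<kappa> where "\<kappa> = (2 * pi) powr (- real DIM('a) / 2)"
  have \<kappa>: "\<kappa> > 0" by (simp add: \<kappa>_def)
  have rho: "\<rho> w = \<kappa> * exp (- hamiltonian U w)" for w
    by (simp add: \<rho>_def gauss_def hamiltonian_def \<kappa>_def case_prod_beta exp_add[symmetric])
  have "\<rho> z * accept z = min (\<rho> z * 1) (\<rho> z * exp (hamiltonian U z - hamiltonian U (flow z)))"
    using \<kappa> unfolding accept_def alphaH_def by (simp only: rho) (simp add: min_mult_distrib_left)
  also have "\<rho> z * exp (hamiltonian U z - hamiltonian U (flow z)) = \<rho> (flow z)"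
    by (simp add: rho exp_diff exp_minus field_simps)
  finally show ?thesis by simp
qed

text \<open>Substituting the volume preserving involution \<open>flip_momentum \<circ> flow\<close> exchanges
  the position with the proposed position and preserves the accepted mass \<open>\<rho> * accept\<close>.\<close>
lemma accepted_mass_symmetric:
  assumes A [measurable]: "A \<in> sets borel"
  shows "(\<integral>\<^sup>+z. ennreal (\<rho> z * accept z) * indicator A (fst (flow z)) \<partial>lborel)
     = (\<integral>\<^sup>+z. ennreal (\<rho> z * accept z) * indicator A (fst z) \<partial>lborel)"
proof -
  let ?F = "flip_momentum \<circ> flow"
  have "volume_preserving ?F"
    unfolding flow_def by (intro volume_preserving_comp volume_preserving_flip volume_preserving_leapfrogT measurable_gradU)
  then have subst: "(\<integral>\<^sup>+z. f (?F z) \<partial>lborel) = (\<integral>\<^sup>+z. f z \<partial>lborel)" if "f \<in> borel_measurable borel" for f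
    using that by (auto simp: volume_preserving_def)
  have "(\<lambda>z. ennreal (\<rho> z * accept z) * indicator A (fst (flow z))) \<in> borel_measurable borel"
    by measurable
  from subst[OF this, symmetric] have "(\<integral>\<^sup>+z. ennreal (\<rho> z * accept z) * indicator A (fst (flow z)) \<partial>lborel)
     = (\<integral>\<^sup>+z. ennreal (\<rho> (?F z) * accept (?F z)) * indicator A (fst (flow (?F z))) \<partial>lborel)"
    .
  also have "\<dots> = (\<integral>\<^sup>+z. ennreal (\<rho> z * accept z) * indicator A (fst z) \<partial>lborel)"
  proof (intro nn_integral_cong)
    fix z
    have fl: "flow (?F z) = flip_momentum z" unfolding flow_def comp_def by (rule leapfrogT_flip)
    have rf: "\<rho> (flip_momentum w) = \<rho> w" for w by (simp add: \<rho>_def flip_momentum_def gauss_def)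
    have "\<rho> (?F z) * accept (?F z) = \<rho> z * accept z"
      unfolding rho_accept fl by (simp add: rf min.commute)
    then show "ennreal (\<rho> (?F z) * accept (?F z)) * indicator A (fst (flow (?F z)))
        = ennreal (\<rho> z * accept z) * indicator A (fst z)"
      unfolding fl by simp
  qed
  finally show ?thesis .
qed

text \<open>Symmetry puts the accepted mass back at its starting position, where it combines with
  the rejected mass to \<open>\<rho>\<close>; the Gaussian factor then integrates to 1.\<close>

lemma nn_integral_exp_emeasure_hmc:
  assumes A [measurable]: "A \<in> sets borel"
  shows "(\<integral>\<^sup>+q. ennreal (exp (- U q)) * emeasure (hmc U gradU h T q) A \<partial>lborel)
     = (\<integral>\<^sup>+q. ennreal (exp (- U q)) * indicator A q \<partial>lborel)"
proof -
  have rho: "\<rho> z \<ge> 0" for z using gauss_pos[of "snd z"] by (simp add: \<rho>_def)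
  have m2: "(\<lambda>z. ennreal (exp (- U (fst z))) * indicator A (fst z) * ennreal (gauss (snd z :: 'a))) \<in> borel_measurable borel"
    by (intro borel_measurable_times_ennreal measurable_compose[OF measurable_exp_U_fst measurable_ennreal]
        measurable_compose[OF measurable_fst_borel borel_measurable_indicator[OF A]]
        measurable_compose[OF measurable_compose[OF measurable_snd_borel measurable_gauss] measurable_ennreal])
  have m1: "(\<lambda>z. ennreal (exp (- U (fst z))) * moved A z) \<in> borel_measurable borel"
    by (intro borel_measurable_times_ennreal measurable_moved[OF A] measurable_compose[OF measurable_exp_U_fst measurable_ennreal])
  have "(\<integral>\<^sup>+q. ennreal (exp (- U q)) * emeasure (hmc U gradU h T q) A \<partial>lborel)
      = (\<integral>\<^sup>+q. \<integral>\<^sup>+p. ennreal (exp (- U q)) * moved A (q, p) \<partial>lborel \<partial>lborel)"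
    using measurable_moved_Pair[OF A] by (simp add: emeasure_hmc[OF A] nn_integral_cmult)
  also have "\<dots> = (\<integral>\<^sup>+z. ennreal (exp (- U (fst z))) * moved A z \<partial>lborel)"
    using m1 by (subst nn_integral_lborel_pair(1)) simp_all
  also have "\<dots> = (\<integral>\<^sup>+z. ennreal (\<rho> z * accept z) * indicator A (fst (flow z))
      + ennreal (\<rho> z * (1 - accept z)) * indicator A (fst z) \<partial>lborel)"
  proof (intro nn_integral_cong)
    fix z
    have *: "ennreal (exp (- U (fst z))) * ennreal (a * gauss (snd z)) = ennreal (\<rho> z * a)" for a
      by (subst ennreal_mult'[symmetric]) (simp_all add: \<rho>_def mult.assoc mult.commute mult.left_commute)
    show "ennreal (exp (- U (fst z))) * moved A z = ennreal (\<rho> z * accept z) * indicator A (fst (flow z))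
      + ennreal (\<rho> z * (1 - accept z)) * indicator A (fst z)"
      unfolding moved_def distrib_left mult.assoc[symmetric] * ..
  qed
  also have "\<dots> = (\<integral>\<^sup>+z. ennreal (\<rho> z * accept z) * indicator A (fst (flow z)) \<partial>lborel)
      + (\<integral>\<^sup>+z. ennreal (\<rho> z * (1 - accept z)) * indicator A (fst z) \<partial>lborel)"
    by (rule nn_integral_add) measurable
  also have "\<dots> = (\<integral>\<^sup>+z. ennreal (\<rho> z * accept z) * indicator A (fst z)
      + ennreal (\<rho> z * (1 - accept z)) * indicator A (fst z) \<partial>lborel)"
    unfolding accepted_mass_symmetric[OF A] by (rule nn_integral_add[symmetric]) measurable
  also have "\<dots> = (\<integral>\<^sup>+z. ennreal (exp (- U (fst z))) * indicator A (fst z) * ennreal (gauss (snd z :: 'a)) \<partial>lborel)"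
  proof (intro nn_integral_cong)
    fix z
    have "ennreal (\<rho> z * accept z) + ennreal (\<rho> z * (1 - accept z)) = ennreal (\<rho> z)"
    proof -
      have "0 \<le> \<rho> z * accept z" "0 \<le> \<rho> z * (1 - accept z)"
        using accept_pos[of z] accept_le_1[of z] rho[of z] by simp_all
      then show ?thesis by (simp add: ennreal_plus[symmetric] right_diff_distrib del: ennreal_plus)
    qed
    also have "\<dots> = ennreal (exp (- U (fst z))) * ennreal (gauss (snd z))"
      unfolding \<rho>_def using gauss_pos[of "snd z"] by (simp add: ennreal_mult')
    finally show "ennreal (\<rho> z * accept z) * indicator A (fst z) + ennreal (\<rho> z * (1 - accept z)) * indicator A (fst z)
      = ennreal (exp (- U (fst z))) * indicator A (fst z) * ennreal (gauss (snd z))"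
      by (simp add: indicator_def)
  qed
  also have "\<dots> = (\<integral>\<^sup>+q. \<integral>\<^sup>+p. ennreal (exp (- U q)) * indicator A q * ennreal (gauss (p :: 'a)) \<partial>lborel \<partial>lborel)"
    using m2 by (subst nn_integral_lborel_pair(1)) simp_all
  also have "\<dots> = (\<integral>\<^sup>+q. ennreal (exp (- U q)) * indicator A q \<partial>lborel)"
    by (simp add: nn_integral_cmult nn_integral_gauss)
  finally show ?thesis .
qed

lemma normalizer_pos: "(\<integral>q. exp (- U q) \<partial>lborel) > 0"
proof -
  have "(\<integral>q. exp (- U q) \<partial>lborel) \<noteq> 0"
  proof
    assume "(\<integral>q. exp (- U q) \<partial>lborel) = 0"
    then have "AE q in lborel. exp (- U q) = 0"
      using integrable_exp by (subst (asm) integral_nonneg_eq_0_iff_AE) auto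
    then have "AE q::'a in lborel. False" by simp
    then show False using emeasure_lborel_cball_pos[of 1 "0::'a"]
      by (simp add: AE_iff_null null_sets_def)
  qed
  moreover have "(\<integral>q. exp (- U q) \<partial>lborel) \<ge> 0" by simp
  ultimately show ?thesis by linarith
qed

lemma sets_target [simp, measurable_cong]: "sets (target U) = sets borel"
  by (simp add: target_def)

lemma target_eq: "target U = density lborel (\<lambda>q. ennreal (1 / (\<integral>q. exp (- U q) \<partial>lborel)) * ennreal (exp (- U q)))"
  unfolding target_def using normalizer_pos by (simp add: ennreal_mult'[symmetric])

lemma prob_target: "prob_space (target U)"
proof (rule prob_spaceI)
  have "emeasure (target U) (space (target U))
     = ennreal (1 / (\<integral>q. exp (- U q) \<partial>lborel)) * (\<integral>\<^sup>+q. ennreal (exp (- U q)) \<partial>lborel)"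
    unfolding target_eq by (simp add: emeasure_density nn_integral_cmult)
  also have "(\<integral>\<^sup>+q. ennreal (exp (- U q)) \<partial>lborel) = ennreal (\<integral>q. exp (- U q) \<partial>lborel)"
    by (rule nn_integral_eq_integral[OF integrable_exp]) simp
  finally show "emeasure (target U) (space (target U)) = 1"
    using normalizer_pos by (simp add: ennreal_mult'[symmetric])
qed

lemma AE_target_iff: "(AE q in target U. P q) \<longleftrightarrow> (AE q in lborel. P q)"
  unfolding target_def using normalizer_pos by (subst AE_density) auto

lemma target_invariant: "target U \<bind> hmc U gradU h T = target U"
proof (rule measure_eqI)
  have K: "hmc U gradU h T \<in> target U \<rightarrow>\<^sub>M subprob_algebra borel"
    using measurable_prob_algebraD[OF measurable_hmc] by (simp cong: measurable_cong_sets)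
  show "sets (target U \<bind> hmc U gradU h T) = sets (target U)"
    using prob_space.not_empty[OF prob_target] by (subst sets_bind[where N=borel]) auto
  fix A assume "A \<in> sets (target U \<bind> hmc U gradU h T)"
  then have A [measurable]: "A \<in> sets borel"
    using prob_space.not_empty[OF prob_target] by (subst (asm) sets_bind[where N=borel]) auto
  let ?c = "ennreal (1 / (\<integral>q. exp (- U q) \<partial>lborel))"
  have m [measurable]: "(\<lambda>q. emeasure (hmc U gradU h T q) A) \<in> borel_measurable borel"
    by (rule measurable_emeasure_kernel[OF measurable_prob_algebraD[OF measurable_hmc] A])
  have "emeasure (target U \<bind> hmc U gradU h T) A = (\<integral>\<^sup>+q. emeasure (hmc U gradU h T q) A \<partial>target U)"
    using K A prob_space.not_empty[OF prob_target] by (intro emeasure_bind)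
  also have "\<dots> = ?c * (\<integral>\<^sup>+q. ennreal (exp (- U q)) * emeasure (hmc U gradU h T q) A \<partial>lborel)"
    unfolding target_eq
    by (subst nn_integral_density) (measurable, simp add: mult.assoc nn_integral_cmult)
  also have "\<dots> = emeasure (target U) A"
    unfolding nn_integral_exp_emeasure_hmc[OF A] unfolding target_eq
    by (subst emeasure_density) (measurable, simp add: mult.assoc nn_integral_cmult)
  finally show "emeasure (target U \<bind> hmc U gradU h T) A = emeasure (target U) A" .
qed

end

section \<open>Minorization of the Hamiltonian Monte Carlo kernel\<close>

lemma fst_leapfrogT_Suc:
  "fst (leapfrogT gradU h (Suc n) z) = fst (leapfrogT gradU h n z) + h *\<^sub>R snd (leapfrogT gradU h n z)
     - (h\<^sup>2 / 2) *\<^sub>R gradU (fst (leapfrogT gradU h n z))"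
  by (simp add: leapfrogT_Suc leapfrog_def psi1_eq psi2_eq scaleR_diff_right power2_eq_square)

lemma snd_leapfrogT_Suc:
  "snd (leapfrogT gradU h (Suc n) z) = snd (leapfrogT gradU h n z)
     - (h / 2) *\<^sub>R (gradU (fst (leapfrogT gradU h n z)) + gradU (fst (leapfrogT gradU h (Suc n) z)))"
  by (simp add: leapfrogT_Suc leapfrog_def psi1_eq psi2_eq scaleR_add_right)

lemma norm_add_diff_scaleR_le:
  fixes a b c :: "'a::real_normed_vector"
  assumes "k \<ge> 0" "l \<ge> 0"
  shows "norm (a + k *\<^sub>R b - l *\<^sub>R c) \<le> norm a + k * norm b + l * norm c"
  using norm_triangle_ineq4[of "a + k *\<^sub>R b" "l *\<^sub>R c"] norm_triangle_ineq[of a "k *\<^sub>R b"] assms by simp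

lemma norm_diff_scaleR_add_le:
  fixes a b c :: "'a::real_normed_vector"
  assumes "k \<ge> 0"
  shows "norm (a - k *\<^sub>R (b + c)) \<le> norm a + k * (norm b + norm c)"
  using norm_triangle_ineq4[of a "k *\<^sub>R (b + c)"] mult_left_mono[OF norm_triangle_ineq[of b c] assms] assms by simp

text \<open>Each step changes the momentum by at most \<open>h * D\<close>; feeding this into the
  positions adds \<open>2 * n + 1\<close> to \<open>n\<^sup>2\<close>. The gradient at the last
  point is included because the closing half step of the momentum uses it.\<close>

lemma leapfrogT_deviation:
  assumes "h \<ge> 0" and D: "\<And>i. i \<le> n \<Longrightarrow> norm (gradU (fst (leapfrogT gradU h i (q, p)))) \<le> D"
  shows "norm (snd (leapfrogT gradU h n (q, p)) - p) \<le> real n * h * D \<and>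
    norm (fst (leapfrogT gradU h n (q, p)) - q - (real n * h) *\<^sub>R p) \<le> h\<^sup>2 * (real n)\<^sup>2 * D / 2"
  using D
proof (induction n)
  case (Suc n)
  let ?Q = "\<lambda>i. fst (leapfrogT gradU h i (q, p))" and ?P = "\<lambda>i. snd (leapfrogT gradU h i (q, p))"
  have IH: "norm (?P n - p) \<le> real n * h * D"
      "norm (?Q n - q - (real n * h) *\<^sub>R p) \<le> h\<^sup>2 * (real n)\<^sup>2 * D / 2"
    using Suc by auto
  have g: "norm (gradU (?Q n)) \<le> D" "norm (gradU (?Q (Suc n))) \<le> D" using Suc.prems by auto
  have eqP: "?P (Suc n) - p = (?P n - p) - (h / 2) *\<^sub>R (gradU (?Q n) + gradU (?Q (Suc n)))"
    by (simp add: snd_leapfrogT_Suc)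
  have "norm (?P (Suc n) - p) \<le> norm (?P n - p) + (h / 2) * (norm (gradU (?Q n)) + norm (gradU (?Q (Suc n))))"
    unfolding eqP using \<open>h \<ge> 0\<close> by (intro norm_diff_scaleR_add_le) simp
  also have "\<dots> \<le> real n * h * D + (h / 2) * (D + D)"
    using IH(1) g \<open>h \<ge> 0\<close> by (intro add_mono mult_left_mono) auto
  finally have 1: "norm (?P (Suc n) - p) \<le> real (Suc n) * h * D" by (simp add: algebra_simps)
  have eq: "?Q (Suc n) - q - (real (Suc n) * h) *\<^sub>R p
      = (?Q n - q - (real n * h) *\<^sub>R p) + h *\<^sub>R (?P n - p) - (h\<^sup>2 / 2) *\<^sub>R gradU (?Q n)"
    by (simp add: fst_leapfrogT_Suc algebra_simps)
  have "norm (?Q (Suc n) - q - (real (Suc n) * h) *\<^sub>R p)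
      \<le> norm (?Q n - q - (real n * h) *\<^sub>R p) + h * norm (?P n - p) + (h\<^sup>2 / 2) * norm (gradU (?Q n))"
    unfolding eq using \<open>h \<ge> 0\<close> by (intro norm_add_diff_scaleR_le) auto
  also have "\<dots> \<le> h\<^sup>2 * (real n)\<^sup>2 * D / 2 + h * (real n * h * D) + (h\<^sup>2 / 2) * D"
    using IH g \<open>h \<ge> 0\<close> by (intro add_mono mult_left_mono) auto
  also have "\<dots> = h\<^sup>2 * (real (Suc n))\<^sup>2 * D / 2" by (simp add: power2_eq_square field_simps)
  finally show ?case using 1 by simp
qed (simp add: assms)

text \<open>The largest gradient \<open>D\<close> along the trajectory bounds the positions, and
  these bound \<open>D\<close> in turn; the smallness condition lets \<open>D\<close> be absorbed.
  The factor 1/2 before the norm of \<open>p\<close> leaves the room that the fixed-point argument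
  needs.\<close>

lemma leapfrogT_deviation_of_growth:
  fixes \<epsilon> C h :: real
  assumes h: "h \<ge> 0" and \<epsilon>: "\<epsilon> \<ge> 0"
    and growth: "\<And>x. norm (gradU x) \<le> \<epsilon> * norm x + C"
    and small: "2 * (h\<^sup>2 * (real T)\<^sup>2) * \<epsilon> \<le> 1"
  shows "norm (fst (leapfrogT gradU h T (q, p)) - q - (real T * h) *\<^sub>R p)
     \<le> (norm q + real T * h * norm p) / 2 + h\<^sup>2 * (real T)\<^sup>2 * C"
proof -
  let ?Q = "\<lambda>i. fst (leapfrogT gradU h i (q, p))"
  define D where "D = Max ((\<lambda>i. norm (gradU (?Q i))) ` {..T})"
  define a where "a = norm q + real T * h * norm p"
  define k where "k = h\<^sup>2 * (real T)\<^sup>2"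
  have D: "norm (gradU (?Q i)) \<le> D" if "i \<le> T" for i
    unfolding D_def using that by (intro Max_ge) auto
  have D0: "D \<ge> 0" using D[of 0] by (meson le0 norm_ge_zero order_trans)
  have k: "k \<ge> 0" by (simp add: k_def)
  have "D \<in> (\<lambda>i. norm (gradU (?Q i))) ` {..T}" unfolding D_def by (intro Max_in) auto
  then obtain j where j: "j \<le> T" "D = norm (gradU (?Q j))" by auto
  have "norm (?Q j - q - (real j * h) *\<^sub>R p) \<le> h\<^sup>2 * (real j)\<^sup>2 * D / 2"
    using leapfrogT_deviation[OF h, of j gradU q p D] D j by auto
  also have "\<dots> \<le> k * D / 2"
    unfolding k_def using j D0 by (intro divide_right_mono mult_right_mono mult_left_mono power_mono) auto
  finally have d: "norm (?Q j - q - (real j * h) *\<^sub>R p) \<le> k * D / 2" .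
  have "norm (?Q j) = norm ((?Q j - q - (real j * h) *\<^sub>R p) + q + (real j * h) *\<^sub>R p)" by simp
  also have "\<dots> \<le> norm (?Q j - q - (real j * h) *\<^sub>R p) + norm q + norm ((real j * h) *\<^sub>R p)"
    by (intro order_trans[OF norm_triangle_ineq] add_right_mono norm_triangle_ineq)
  also have "norm ((real j * h) *\<^sub>R p) \<le> real T * h * norm p"
    using j h by (simp add: mult_right_mono)
  finally have Qj: "norm (?Q j) \<le> k * D / 2 + a" using d by (simp add: a_def)
  have "D \<le> \<epsilon> * norm (?Q j) + C" using growth j(2) by simp
  also have "\<dots> \<le> \<epsilon> * (k * D / 2 + a) + C" using Qj \<epsilon> by (intro add_right_mono mult_left_mono)
  finally have "D \<le> (k * \<epsilon>) * D / 2 + \<epsilon> * a + C" by (simp add: algebra_simps)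
  have ke: "k * \<epsilon> \<le> 1 / 2" using small by (simp add: k_def)
  then have "(k * \<epsilon>) * D \<le> 1 / 2 * D" using D0 by (intro mult_right_mono)
  \<comment> \<open>Absorption leaves three quarters of \<open>D\<close> on the left, so the factor
    4/3 would be possible; 2 cancels the half in the deviation bound.\<close>
  have D2: "D \<le> 2 * (\<epsilon> * a + C)"
    using D0
  proof -
    have "d \<le> 2 * e" if "d \<le> w / 2 + e" "w \<le> 1 / 2 * d" "0 \<le> d" for d w e :: real
      using that by linarith
    from this[of D "k * \<epsilon> * D" "\<epsilon> * a + C"] show ?thesis
      using \<open>D \<le> (k * \<epsilon>) * D / 2 + \<epsilon> * a + C\<close> \<open>(k * \<epsilon>) * D \<le> 1 / 2 * D\<close> D0 by simp
  qed
  have a0: "a \<ge> 0" using h by (simp add: a_def)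
  have "norm (?Q T - q - (real T * h) *\<^sub>R p) \<le> k * D / 2"
    using leapfrogT_deviation[OF h, of T gradU q p D] D by (auto simp: k_def)
  also have "\<dots> \<le> k * (\<epsilon> * a + C)" using mult_left_mono[OF D2 k] by (simp add: algebra_simps)
  also have "\<dots> = (k * \<epsilon>) * a + k * C" by (simp add: algebra_simps)
  also have "\<dots> \<le> 1 / 2 * a + k * C" using ke a0 by (intro add_right_mono mult_right_mono)
  finally show ?thesis by (simp add: a_def k_def)
qed

text \<open>Position and momentum feed into each other and are estimated together. The global
  Lipschitz constant of the gradient makes the result uniform in \<open>q\<close>.\<close>

lemma leapfrogT_momentum_lipschitz:
  fixes gradU :: "'a::euclidean_space \<Rightarrow> 'a"
  assumes L: "L \<ge> 0" and lip: "\<And>x y. norm (gradU x - gradU y) \<le> L * norm (x - y)" and h: "h \<ge> 0"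
  obtains \<Lambda> where "\<Lambda> > 0"
    "\<And>q p p'. norm (fst (leapfrogT gradU h n (q, p)) - fst (leapfrogT gradU h n (q, p'))) \<le> \<Lambda> * norm (p - p')"
proof -
  have "\<exists>a b. 0 \<le> a \<and> (\<forall>q p p'.
      norm (fst (leapfrogT gradU h n (q, p)) - fst (leapfrogT gradU h n (q, p'))) \<le> a * norm (p - p') \<and>
      norm (snd (leapfrogT gradU h n (q, p)) - snd (leapfrogT gradU h n (q, p'))) \<le> b * norm (p - p'))"
  proof (induction n)
    case 0
    show ?case by (intro exI[of _ 0] exI[of _ 1]) simp
  next
    case (Suc n)
    then obtain a b where a: "0 \<le> a"
      and ab: "\<And>q p p'. norm (fst (leapfrogT gradU h n (q, p)) - fst (leapfrogT gradU h n (q, p'))) \<le> a * norm (p - p')"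
        "\<And>q p p'. norm (snd (leapfrogT gradU h n (q, p)) - snd (leapfrogT gradU h n (q, p'))) \<le> b * norm (p - p')"
      by blast
    \<comment> \<open>The absolute value appears because the induction carries no sign for
      \<open>b\<close>.\<close>
    define a' where "a' = a + h * \<bar>b\<bar> + (h\<^sup>2 / 2) * (L * a)"
    define b' where "b' = b + (h / 2) * (L * a + L * a')"
    have "norm (fst (leapfrogT gradU h (Suc n) (q, p)) - fst (leapfrogT gradU h (Suc n) (q, p'))) \<le> a' * norm (p - p') \<and>
      norm (snd (leapfrogT gradU h (Suc n) (q, p)) - snd (leapfrogT gradU h (Suc n) (q, p'))) \<le> b' * norm (p - p')" for q p p'
    proof -
      let ?Q = "\<lambda>i p. fst (leapfrogT gradU h i (q, p))" and ?P = "\<lambda>i p. snd (leapfrogT gradU h i (q, p))"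
      let ?d = "norm (p - p')"
      have g: "norm (gradU (?Q i p) - gradU (?Q i p')) \<le> L * (c * ?d)"
        if "norm (?Q i p - ?Q i p') \<le> c * ?d" for i c
        using lip[of "?Q i p" "?Q i p'"] mult_left_mono[OF that L] by linarith
      have eq: "?Q (Suc n) p - ?Q (Suc n) p' = (?Q n p - ?Q n p') + h *\<^sub>R (?P n p - ?P n p')
          - (h\<^sup>2 / 2) *\<^sub>R (gradU (?Q n p) - gradU (?Q n p'))"
        by (simp add: fst_leapfrogT_Suc algebra_simps)
      have "norm (?Q (Suc n) p - ?Q (Suc n) p') \<le> norm (?Q n p - ?Q n p') + h * norm (?P n p - ?P n p')
          + (h\<^sup>2 / 2) * norm (gradU (?Q n p) - gradU (?Q n p'))"
        unfolding eq using h by (intro norm_add_diff_scaleR_le) auto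
      also have "\<dots> \<le> a * ?d + h * (\<bar>b\<bar> * ?d) + (h\<^sup>2 / 2) * (L * (a * ?d))"
        using h by (intro add_mono mult_left_mono ab g order_trans[OF ab(2)] mult_right_mono) auto
      finally have 1: "norm (?Q (Suc n) p - ?Q (Suc n) p') \<le> a' * ?d" by (simp add: a'_def algebra_simps)
      have eq: "?P (Suc n) p - ?P (Suc n) p' = (?P n p - ?P n p')
          - (h / 2) *\<^sub>R ((gradU (?Q n p) - gradU (?Q n p')) + (gradU (?Q (Suc n) p) - gradU (?Q (Suc n) p')))"
        by (simp add: snd_leapfrogT_Suc algebra_simps)
      have "norm (?P (Suc n) p - ?P (Suc n) p') \<le> norm (?P n p - ?P n p')
          + (h / 2) * (norm (gradU (?Q n p) - gradU (?Q n p')) + norm (gradU (?Q (Suc n) p) - gradU (?Q (Suc n) p')))"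
        unfolding eq using h by (intro norm_diff_scaleR_add_le) auto
      also have "\<dots> \<le> b * ?d + (h / 2) * (L * (a * ?d) + L * (a' * ?d))"
        using h 1 by (intro add_mono mult_left_mono ab g) auto
      finally have 2: "norm (?P (Suc n) p - ?P (Suc n) p') \<le> b' * ?d" by (simp add: b'_def algebra_simps)
      from 1 2 show ?thesis by blast
    qed
    moreover have "0 \<le> a'" using a h L by (simp add: a'_def)
    ultimately show ?case by blast
  qed
  then obtain a where a: "0 \<le> a"
    "\<And>q p p'. norm (fst (leapfrogT gradU h n (q, p)) - fst (leapfrogT gradU h n (q, p'))) \<le> a * norm (p - p')"
    by blast
  \<comment> \<open>Adding 1 makes the constant positive even when \<open>a\<close> is 0, as it may
    be for \<open>n = 0\<close>.\<close>
  show ?thesis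
  proof (rule that[of "a + 1"])
    show "norm (fst (leapfrogT gradU h n (q, p)) - fst (leapfrogT gradU h n (q, p'))) \<le> (a + 1) * norm (p - p')" for q p p'
      using a(2)[of q p p'] by (simp add: distrib_right add_increasing2)
  qed (use a in simp)
qed

text \<open>Solutions of \<open>f p = y\<close> are the fixed points of
  \<open>p - (1 / s) *\<^sub>R (f p - y)\<close>, and the deviation bound says that this map sends
  the ball into itself.\<close>

lemma brouwer_perturbation_surj:
  fixes f :: "'a::euclidean_space \<Rightarrow> 'a"
  assumes cont: "continuous_on UNIV f" and s: "s > 0" and R: "R > 0"
    and dev: "\<And>p. norm p \<le> R \<Longrightarrow> norm (f p - s *\<^sub>R p - y) \<le> s * R"
  obtains p where "norm p \<le> R" "f p = y"
proof -
  let ?g = "\<lambda>p. p - (1 / s) *\<^sub>R (f p - y)"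
  have "?g \<in> cball 0 R \<rightarrow> cball 0 R"
  proof
    fix p :: 'a assume "p \<in> cball 0 R"
    then have "norm (f p - s *\<^sub>R p - y) \<le> s * R" by (intro dev) simp
    moreover have "?g p = - (1 / s) *\<^sub>R (f p - s *\<^sub>R p - y)"
      using s by (simp add: algebra_simps)
    then have "norm (?g p) = norm (f p - s *\<^sub>R p - y) / s"
      using s by (simp add: divide_inverse mult.commute)
    moreover have "norm (f p - s *\<^sub>R p - y) / s \<le> R" if "norm (f p - s *\<^sub>R p - y) \<le> s * R"
      using s that by (simp add: pos_divide_le_eq mult.commute)
    ultimately have "norm (?g p) \<le> R" by (simp only:)
    then show "?g p \<in> cball 0 R" by simp
  qed
  moreover have "continuous_on (cball 0 R) ?g"
    by (intro continuous_intros continuous_on_subset[OF cont]) auto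
  ultimately obtain p where "p \<in> cball 0 R" "?g p = p" using brouwer_ball[OF R, of 0 ?g] by blast
  then show ?thesis using s that[of p] by auto
qed

context hmc_chain
begin

lemma hmc_minorization:
  assumes h: "h > 0" and T: "T \<ge> 1" and L: "L \<ge> 0" and \<epsilon>: "\<epsilon> \<ge> 0"
    and lip: "\<And>x y. norm (gradU x - gradU y) \<le> L * norm (x - y)"
    and growth: "\<And>x. norm (gradU x) \<le> \<epsilon> * norm x + C"
    and small: "2 * (h\<^sup>2 * (real T)\<^sup>2) * \<epsilon> \<le> 1"
    and r: "r > 0"
  shows "\<exists>c>0. \<forall>q\<in>cball 0 r. \<forall>A\<in>sets borel. A \<subseteq> cball 0 r \<longrightarrow>
           ennreal c * emeasure lborel A \<le> emeasure (hmc U gradU h T q) A"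
proof -
  have C: "C \<ge> 0" using order_trans[OF norm_ge_zero growth[of 0]] by simp
  define s where "s = real T * h"
  have s: "s > 0" using h T by (simp add: s_def)
  define k where "k = h\<^sup>2 * (real T)\<^sup>2 * C"
  have k: "k \<ge> 0" using C by (simp add: k_def)
  \<comment> \<open>This gives \<open>s * R = 6 * r + 2 * k\<close>. The deviation that Brouwer's
    theorem must control is at most \<open>s * R / 2 + 5 * r / 2 + k\<close>, hence at most
    \<open>s * R\<close>.\<close>
  define R where "R = 2 * (3 * r + k) / s"
  have R: "R > 0" unfolding R_def using r k s by (intro divide_pos_pos mult_pos_pos add_pos_nonneg) auto
  obtain \<Lambda> where \<Lambda>: "\<Lambda> > 0"
    and lipf: "\<And>q p p'. norm (fst (flow (q, p)) - fst (flow (q, p'))) \<le> \<Lambda> * norm (p - p')"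
    unfolding flow_def using leapfrogT_momentum_lipschitz[OF L lip less_imp_le[OF h], of T] by metis
  have contf: "continuous_on UNIV (\<lambda>p. fst (flow (q, p)))" for q
    by (intro continuous_on_fst continuous_on_compose2[OF continuous_flow]) (auto intro!: continuous_intros)
  have surj: "\<exists>p. norm p \<le> R \<and> fst (flow (q, p)) = y" if q: "norm q \<le> r" and y: "norm y \<le> r" for q y
  proof -
    have "norm (fst (flow (q, p)) - s *\<^sub>R p - y) \<le> s * R" if p: "norm p \<le> R" for p
    proof -
      have "norm (fst (flow (q, p)) - q - s *\<^sub>R p) \<le> (norm q + s * norm p) / 2 + k"
        using leapfrogT_deviation_of_growth[OF less_imp_le[OF h] \<epsilon> growth small] by (simp add: s_def k_def flow_def)
      moreover have "s * norm p \<le> s * R" using p s by (intro mult_left_mono) auto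
      moreover have "norm (fst (flow (q, p)) - s *\<^sub>R p - y)
          \<le> norm (fst (flow (q, p)) - q - s *\<^sub>R p) + (norm q + norm y)"
      proof -
        have "norm ((fst (flow (q, p)) - q - s *\<^sub>R p) + (q - y))
            \<le> norm (fst (flow (q, p)) - q - s *\<^sub>R p) + (norm q + norm y)"
          by (intro order_trans[OF norm_triangle_ineq] add_left_mono norm_triangle_ineq4)
        then show ?thesis by simp
      qed
      moreover have "s * R = 6 * r + 2 * k" using s by (simp add: R_def)
      ultimately show ?thesis using q y r by argo
    qed
    with brouwer_perturbation_surj[OF contf s R] show ?thesis by metis
  qed
  \<comment> \<open>One unit larger than the ball of preimages, so that a unit ball around each of
    them fits.\<close>
  define S where "S = cball (0::'a) (R + 1)"
  \<comment> \<open>Acceptance probability and Gaussian weight are continuous and positive, so on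
    this compact set they have a positive lower bound that serves all starts at once.\<close>
  have "compact (cball (0::'a) r \<times> S)" "cball (0::'a) r \<times> S \<noteq> {}"
    unfolding S_def using r R by (auto intro: compact_Times)
  moreover have "continuous_on (cball 0 r \<times> S) (\<lambda>z. accept z * gauss (snd z))"
    by (intro continuous_on_mult continuous_on_subset[OF continuous_accept]
         continuous_on_compose2[OF continuous_gauss continuous_on_snd]) (auto intro: continuous_intros)
  ultimately obtain z0 where z0: "\<And>z. z \<in> cball 0 r \<times> S \<Longrightarrow> accept z0 * gauss (snd z0) \<le> accept z * gauss (snd z)"
    using continuous_attains_inf[of "cball 0 r \<times> S" "\<lambda>z. accept z * gauss (snd z)"] by blast
  define m where "m = accept z0 * gauss (snd z0)"
  have m: "m > 0" by (simp add: m_def accept_pos gauss_pos)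
  define c where "c = m * inverse \<Lambda> ^ DIM('a)"
  have "ennreal c * emeasure lborel A \<le> emeasure (hmc U gradU h T q) A"
    if q: "q \<in> cball 0 r" and A: "A \<in> sets borel" "A \<subseteq> cball 0 r" for q A
  proof -
    let ?f = "\<lambda>p. fst (flow (q, p))"
    have f: "?f \<in> borel_measurable borel" using contf by (rule borel_measurable_continuous_onI)
    have SA: "S \<inter> ?f -` A \<in> sets borel" using measurable_sets[OF f A(1)] by (auto simp: S_def)
    have "ennreal (inverse \<Lambda> ^ DIM('a)) * emeasure lborel A \<le> emeasure lborel (S \<inter> ?f -` A)"
    proof (rule lipschitz_preimage_measure_ge[OF \<Lambda> lipf])
      fix y assume "y \<in> A"
      then have "norm y \<le> r" "norm q \<le> r" using A(2) q by auto
      then obtain p where p: "norm p \<le> R" "fst (flow (q, p)) = y" using surj by blast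
      have "ball p 1 \<subseteq> S"
      proof
        fix x assume "x \<in> ball p 1"
        then show "x \<in> S" using p(1) norm_triangle_ineq4[of p "p - x"] by (simp add: S_def dist_norm)
      qed
      with p show "\<exists>x. fst (flow (q, x)) = y \<and> ball x 1 \<subseteq> S" by blast
    qed (use A(1) emeasure_lborel_cball_finite in \<open>auto simp: S_def\<close>)
    then have "ennreal c * emeasure lborel A \<le> ennreal m * emeasure lborel (S \<inter> ?f -` A)"
      unfolding c_def using m \<Lambda> by (simp add: ennreal_mult mult.assoc mult_left_mono)
    also have "\<dots> = (\<integral>\<^sup>+p. ennreal m * indicator (S \<inter> ?f -` A) p \<partial>lborel)"
      using SA by (simp add: nn_integral_cmult_indicator)
    also have "\<dots> \<le> (\<integral>\<^sup>+p. moved A (q, p) \<partial>lborel)"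
    proof (intro nn_integral_mono)
      fix p
      have "ennreal m \<le> ennreal (accept (q, p) * gauss p)" if "p \<in> S"
        using z0[of "(q, p)"] q that by (intro ennreal_leI) (simp add: m_def)
      then show "ennreal m * indicator (S \<inter> ?f -` A) p \<le> moved A (q, p)"
        by (auto simp: moved_def indicator_def intro: add_increasing2)
    qed
    also have "\<dots> = emeasure (hmc U gradU h T q) A" by (rule emeasure_hmc[OF A(1), symmetric])
    finally show ?thesis .
  qed
  moreover have "c > 0" using m \<Lambda> by (simp add: c_def)
  ultimately show ?thesis by blast
qed

text \<open>\<open>\<epsilon>\<close> is the linear growth rate of the gradient. The two cases of
  the theorem differ only in whether \<open>\<epsilon>\<close> is chosen after \<open>h\<close> and
  \<open>T\<close>, or \<open>h\<close> after \<open>\<epsilon>\<close> and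
  \<open>T\<close>.\<close>

lemma hmc_conclusions:
  assumes h: "h > 0" and T: "T \<ge> 1" and L: "L \<ge> 0" and \<epsilon>: "\<epsilon> \<ge> 0"
    and lip: "\<And>x y. norm (gradU x - gradU y) \<le> L * norm (x - y)"
    and growth: "\<And>x. norm (gradU x) \<le> \<epsilon> * norm x + C"
    and small: "2 * (h\<^sup>2 * (real T)\<^sup>2) * \<epsilon> \<le> 1"
  shows "irreducible (hmc U gradU h T) \<and>
          irreducibility_measure (hmc U gradU h T) lborel \<and>
          (\<forall>C. compact C \<longrightarrow> small_set (hmc U gradU h T) C) \<and>
          aperiodic (hmc U gradU h T) \<and>
          recurrent (hmc U gradU h T) \<and>
          (AE q in target U. (\<lambda>n. tv_dist_kpow (hmc U gradU h T) n q (target U)) \<longlonglongrightarrow> 0)"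
proof -
  interpret ball_minorized_chain "hmc U gradU h T" "target U"
  proof (intro ball_minorized_chain.intro markov_kernel.intro ball_minorized_chain_axioms.intro)
    show "hmc U gradU h T \<in> borel \<rightarrow>\<^sub>M prob_algebra borel" by (rule measurable_hmc)
    show "prob_space (target U)" by (rule prob_target)
    show "sets (target U) = sets borel" by simp
    show "target U \<bind> hmc U gradU h T = target U" by (rule target_invariant)
    show "(AE x in target U. P x) \<longleftrightarrow> (AE x in lborel. P x)" for P by (rule AE_target_iff)
    show "\<exists>c>0. \<forall>x\<in>cball 0 r. \<forall>A\<in>sets borel. A \<subseteq> cball 0 r \<longrightarrow>
           ennreal c * emeasure lborel A \<le> emeasure (hmc U gradU h T x) A" if "r > 0" for r
      by (rule hmc_minorization[OF h T L \<epsilon> lip growth small that])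
  qed
  show ?thesis
    using irreducible irreducibility_lborel small_set_compact aperiodic recurrent AE_tv_dist_tendsto by blast
qed

end

text \<open>For \<open>\<beta> < 1\<close> the gradient grows sublinearly, so its linear growth rate can be made
  as small as the given \<open>h\<close> and \<open>T\<close> require.\<close>
lemma sublinear_rpow:
  assumes \<beta>: "0 \<le> \<beta>" "\<beta> < 1" and \<epsilon>: "\<epsilon> > 0" and M: "M \<ge> (0::real)"
  obtains C where "\<And>t. t \<ge> 0 \<Longrightarrow> M * (1 + rpow t \<beta>) \<le> \<epsilon> * t + C"
proof (cases "\<beta> = 0")
  case True
  \<comment> \<open>Here \<open>rpow\<close> is constantly 1, also at 0, where \<open>powr\<close>
    would give 0.\<close>
  then have "M * (1 + rpow t \<beta>) \<le> \<epsilon> * t + 2 * M" if "t \<ge> 0" for t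
    using \<epsilon> that by (simp add: rpow_def)
  then show ?thesis by (rule that)
next
  case False
  have "((\<lambda>t. M * t powr (\<beta> - 1)) \<longlongrightarrow> M * 0) at_top"
    using \<beta> by (intro tendsto_mult tendsto_const tendsto_neg_powr filterlim_ident) auto
  then have "eventually (\<lambda>t. M * t powr (\<beta> - 1) < \<epsilon>) at_top"
    using \<epsilon> by (intro order_tendstoD(2)) auto
  then obtain X0 where X0: "\<And>t. t \<ge> X0 \<Longrightarrow> M * t powr (\<beta> - 1) < \<epsilon>"
    by (auto simp: eventually_at_top_linorder)
  \<comment> \<open>The maximum with 1 makes every \<open>t\<close> beyond \<open>X\<close>
    positive, which splitting the power requires.\<close>
  define X where "X = max X0 1"
  have "M * (1 + rpow t \<beta>) \<le> \<epsilon> * t + M * (1 + X powr \<beta>)" if t: "t \<ge> 0" for t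
  proof (cases "t \<le> X")
    case True
    then have "M * (1 + t powr \<beta>) \<le> M * (1 + X powr \<beta>)"
      using \<beta> M t by (intro mult_left_mono add_left_mono powr_mono2) auto
    moreover have "0 \<le> \<epsilon> * t" using \<epsilon> t by simp
    ultimately show ?thesis using False by (simp add: rpow_def)
  next
    case F: False
    then have t1: "t \<ge> X0" "t > 0" by (auto simp: X_def)
    have "t powr \<beta> = t powr (\<beta> - 1) * t" using t1 powr_add[of t "\<beta> - 1" 1] by simp
    then have "M * t powr \<beta> = (M * t powr (\<beta> - 1)) * t" by simp
    also have "\<dots> \<le> \<epsilon> * t" using X0[OF t1(1)] t1 by (intro mult_right_mono) auto
    finally have "M * t powr \<beta> \<le> \<epsilon> * t" .
    moreover have "0 \<le> M * X powr \<beta>" using M by simp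
    ultimately show ?thesis using False by (simp add: rpow_def distrib_left)
  qed
  then show ?thesis by (rule that)
qed

theorem theorem3:
  fixes U :: "'a::euclidean_space \<Rightarrow> real" and gradU :: "'a \<Rightarrow> 'a"
    and \<beta> L1 M1 :: real
  assumes grad: "\<And>q. (U has_derivative (\<lambda>v. gradU q \<bullet> v)) (at q)"
    and grad_cont: "continuous_on UNIV gradU"
    and integrable: "integrable lborel (\<lambda>q. exp (- U q))"
    and beta: "0 \<le> \<beta>" "\<beta> \<le> 1"
    and L1: "L1 \<ge> 0" and M1: "M1 \<ge> 0"
    and lip: "\<And>q q'. norm (gradU q - gradU q') \<le> L1 * norm (q - q')"
    and growth: "\<And>q. norm (gradU q) \<le> M1 * (1 + rpow (norm q) \<beta>)"
  shows
    "(\<beta> < 1 \<longrightarrow>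
       (\<forall>h>0. \<forall>T::nat. T \<ge> 1 \<longrightarrow>
          irreducible (hmc U gradU h T) \<and>
          irreducibility_measure (hmc U gradU h T) lborel \<and>
          (\<forall>C. compact C \<longrightarrow> small_set (hmc U gradU h T) C) \<and>
          aperiodic (hmc U gradU h T) \<and>
          recurrent (hmc U gradU h T) \<and>
          (AE q in target U. (\<lambda>n. tv_dist_kpow (hmc U gradU h T) n q (target U)) \<longlonglongrightarrow> 0)))
   \<and>
    (\<beta> = 1 \<longrightarrow>
       (\<forall>T::nat. T \<ge> 1 \<longrightarrow> (\<exists>hbar>0. \<forall>h. 0 < h \<and> h \<le> hbar \<longrightarrow>
          irreducible (hmc U gradU h T) \<and>
          irreducibility_measure (hmc U gradU h T) lborel \<and>
          (\<forall>C. compact C \<longrightarrow> small_set (hmc U gradU h T) C) \<and>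
          aperiodic (hmc U gradU h T) \<and>
          recurrent (hmc U gradU h T) \<and>
          (AE q in target U. (\<lambda>n. tv_dist_kpow (hmc U gradU h T) n q (target U)) \<longlonglongrightarrow> 0))))"
proof -
  have "continuous_on UNIV U"
    using has_derivative_continuous[OF grad] by (simp add: continuous_on_eq_continuous_at)
  then have chain: "hmc_chain U gradU" using grad_cont integrable by (intro hmc_chain.intro)
  note conclusions = hmc_chain.hmc_conclusions[OF chain _ _ L1 _ lip]
  show ?thesis
  proof (intro conjI[of "\<beta> < 1 \<longrightarrow> _"] impI allI)
    fix h :: real and T :: nat assume \<beta>: "\<beta> < 1" and h: "h > 0" and T: "T \<ge> 1"
    \<comment> \<open>The largest growth rate that the smallness condition admits.\<close>
    define \<epsilon> where "\<epsilon> = 1 / (2 * (h\<^sup>2 * (real T)\<^sup>2))"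
    have \<epsilon>: "\<epsilon> > 0" using h T by (simp add: \<epsilon>_def)
    obtain C where C: "\<And>t. t \<ge> 0 \<Longrightarrow> M1 * (1 + rpow t \<beta>) \<le> \<epsilon> * t + C"
      using sublinear_rpow[OF beta(1) \<beta> \<epsilon> M1] by blast
    show "irreducible (hmc U gradU h T) \<and>
          irreducibility_measure (hmc U gradU h T) lborel \<and>
          (\<forall>C. compact C \<longrightarrow> small_set (hmc U gradU h T) C) \<and>
          aperiodic (hmc U gradU h T) \<and>
          recurrent (hmc U gradU h T) \<and>
          (AE q in target U. (\<lambda>n. tv_dist_kpow (hmc U gradU h T) n q (target U)) \<longlonglongrightarrow> 0)"
    proof (rule conclusions[OF h T less_imp_le[OF \<epsilon>]])
      show "norm (gradU x) \<le> \<epsilon> * norm x + C" for x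
        using growth[of x] C[of "norm x"] by simp
      show "2 * (h\<^sup>2 * (real T)\<^sup>2) * \<epsilon> \<le> 1" using h T by (simp add: \<epsilon>_def)
    qed
  next
    fix T :: nat assume \<beta>: "\<beta> = 1" and T: "T \<ge> 1"
    \<comment> \<open>With growth rate \<open>M1\<close>, smallness reads
      \<open>2 * (h * T)\<^sup>2 * M1 \<le> 1\<close>. Here \<open>h * T\<close> is at most
      \<open>1 / (2 * M1 + 1)\<close>, hence at most 1, so squaring does not increase it and the
      factor \<open>2 * M1\<close> is compensated. The summand 1 also covers
      \<open>M1 = 0\<close>.\<close>
    define hbar where "hbar = 1 / (real T * (2 * M1 + 1))"
    have "hbar > 0" using T M1 by (simp add: hbar_def)
    moreover have "irreducible (hmc U gradU h T) \<and>
          irreducibility_measure (hmc U gradU h T) lborel \<and>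
          (\<forall>C. compact C \<longrightarrow> small_set (hmc U gradU h T) C) \<and>
          aperiodic (hmc U gradU h T) \<and>
          recurrent (hmc U gradU h T) \<and>
          (AE q in target U. (\<lambda>n. tv_dist_kpow (hmc U gradU h T) n q (target U)) \<longlonglongrightarrow> 0)"
      if h: "0 < h \<and> h \<le> hbar" for h
    proof (rule conclusions[OF conjunct1[OF h] T M1])
      show "norm (gradU x) \<le> M1 * norm x + M1" for x
        using growth[of x] \<beta> by (simp add: rpow_def algebra_simps)
      have "h * real T * (2 * M1 + 1) \<le> 1"
      proof -
        have "0 < real T * (2 * M1 + 1)" using T M1 by simp
        then show ?thesis using h by (simp add: hbar_def pos_le_divide_eq mult.assoc)
      qed
      then have *: "h * real T \<le> 1 / (2 * M1 + 1)" using M1 by (simp add: field_simps)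
      have "(h * real T)\<^sup>2 \<le> (1 / (2 * M1 + 1))\<^sup>2" using * h by (intro power_mono) auto
      also have "\<dots> \<le> 1 / (2 * M1 + 1)"
        using power_decreasing[of 1 2 "1 / (2 * M1 + 1)"] M1 by simp
      finally have "(h * real T)\<^sup>2 * (2 * M1) \<le> 1 / (2 * M1 + 1) * (2 * M1)"
        using M1 by (intro mult_right_mono) auto
      also have "\<dots> \<le> 1" using M1 by (simp add: field_simps)
      finally show "2 * (h\<^sup>2 * (real T)\<^sup>2) * M1 \<le> 1" by (simp add: power_mult_distrib algebra_simps)
    qed
    ultimately show "\<exists>hbar>0. \<forall>h. 0 < h \<and> h \<le> hbar \<longrightarrow>
          irreducible (hmc U gradU h T) \<and>
          irreducibility_measure (hmc U gradU h T) lborel \<and>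
          (\<forall>C. compact C \<longrightarrow> small_set (hmc U gradU h T) C) \<and>
          aperiodic (hmc U gradU h T) \<and>
          recurrent (hmc U gradU h T) \<and>
          (AE q in target U. (\<lambda>n. tv_dist_kpow (hmc U gradU h T) n q (target U)) \<longlonglongrightarrow> 0)" by blast
  qed
qed

end
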